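(* Let $(\mathbf{s}_\kappa)_{\kappa\in\mathbb{N}}$ be degree sequences with $\mathbf{n}_\kappa:=n(\mathbf{s}_\kappa)\to\infty$, let $\mathbf{p}_\kappa=(s_\kappa^{(i)}/\mathbf{n}_\kappa,\ i\ge 0)$ and $\Delta_\kappa=\max\{i:s_\kappa^{(i)}>0\}$. Suppose that there exists a probability distribution $\mathbf{p}=(p^{(i)}, i\ge 0)$ on $\{0,1,2,\dots\}$ with $p^{(1)}<1$ such that $\mathbf{p}_\kappa\to\mathbf{p}$ coordinatewise, that $\sigma(\mathbf{p}_\kappa)\to\sigma(\mathbf{p})\in(0,\infty)$, that $\frac{c(\mathbf{s}_\kappa)}{\sigma(\mathbf{p}_\kappa)\mathbf{n}_\kappa^{1/2}}\to\lambda\in(0,\infty)$, and that there exists $\epsilon>0$ such that $\Delta_\kappa=O(\mathbf{n}_\kappa^{\frac{1-\epsilon}{2}})$. Then for all $a>0$, $$\lim_{j\to\infty}\limsup_{\kappa\to\infty}\mathbf{P}\Big(\sup_{l>j}\mathrm{diam}(\mathcal{T}_{\kappa,l})>a\Big)=0.$$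
   Context: A rooted plane tree is a finite rooted tree in which the children of each vertex are ordered; the degree of a vertex is its number of children. A rooted plane forest is a finite sequence of rooted plane trees. A degree sequence is a sequence $\mathbf{s}=(s^{(i)},i\ge0)$ of non-negative integers with $n(\mathbf{s}):=\sum_i s^{(i)}<\infty$ and $c(\mathbf{s}):=\sum_i(1-i)s^{(i)}>0$. A forest has degree sequence $\mathbf{s}$ if for each $i$ exactly $s^{(i)}$ of its vertices have degree $i$; it then has $c(\mathbf{s})$ trees. $\mathbb{F}(\mathbf{s})$ is uniform among plane forests with degree sequence $\mathbf{s}$. For a probability distribution $\mathbf{q}=(q^{(i)})_{i\ge0}$, $\sigma^2(\mathbf{q}):=\sum_i i^2q^{(i)}-1$, and $\sigma(\mathbf{q})$ is the square root of its positive part. Let $\mathbb{T}_{\kappa,1},\mathbb{T}_{\kappa,2},\dots$ be the trees of $\mathbb{F}(\mathbf{s}_\kappa)$ in decreasing order of number of vertices (ties broken by a fixed rule: lexicographically, then by order of appearance). $\mathcal{T}_{\kappa,l}$ is the metric space $(\mathbb{T}_{\kappa,l},\frac{\sigma(\mathbf{p}_\kappa)}{2\mathbf{n}_\kappa^{1/2}}d_{gr})$, $d_{gr}$ being graph distance (rooted at the root, with mass $1/\mathbf{n}_\kappa$ on each vertex). For $l>c(\mathbf{s}_\kappa)$, $\mathcal{T}_{\kappa,l}$ is a one-point space (diameter $0$). *)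

theory Defs
  imports "HOL-Probability.Probability" "HOL-Library.Landau_Symbols" "HOL-Library.List_Lexorder"
begin

datatype plane_tree = PNode "plane_tree list"

type_synonym plane_forest = "plane_tree list"

lemma size_nth_less [termination_simp]:
  "i < length ts \<Longrightarrow> size (ts ! i) < Suc (size_list size ts)"
  by (meson le_imp_less_Suc nth_mem order_refl size_list_estimation')

text \<open>Vertices are represented by their Ulam--Harris addresses: the root is the empty list and
  the children of \<open>v\<close> are \<open>v @ [0]\<close>, \<open>v @ [1]\<close>, and so on.\<close>

fun vertices :: "plane_tree \<Rightarrow> nat list set" where
  "vertices (PNode ts) = insert [] (\<Union>i\<in>{..<length ts}. (#) i ` vertices (ts ! i))"

definition vertex_degree :: "plane_tree \<Rightarrow> nat list \<Rightarrow> nat" where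
  "vertex_degree t v = card {i. v @ [i] \<in> vertices t}"

definition tree_edges :: "plane_tree \<Rightarrow> (nat list \<times> nat list) set" where
  "tree_edges t =
    {(u, v). u \<in> vertices t \<and> v \<in> vertices t \<and> (\<exists>i. v = u @ [i] \<or> u = v @ [i])}"

definition graph_dist :: "plane_tree \<Rightarrow> nat list \<Rightarrow> nat list \<Rightarrow> nat" where
  "graph_dist t u v = (LEAST k. (u, v) \<in> tree_edges t ^^ k)"

definition deg_seq_size :: "(nat \<Rightarrow> nat) \<Rightarrow> nat" where
  "deg_seq_size s = (\<Sum>i | s i > 0. s i)"

definition deg_seq_trees :: "(nat \<Rightarrow> nat) \<Rightarrow> int" where
  "deg_seq_trees s = (\<Sum>i | s i > 0. (1 - int i) * int (s i))"

text \<open>For natural-number valued \<open>s\<close>, the sum of all \<open>s i\<close> is finite iff \<open>s\<close> has finite support.\<close>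

definition degree_sequence :: "(nat \<Rightarrow> nat) \<Rightarrow> bool" where
  "degree_sequence s \<longleftrightarrow> finite {i. s i > 0} \<and> deg_seq_trees s > 0"

definition max_degree :: "(nat \<Rightarrow> nat) \<Rightarrow> nat" where
  "max_degree s = Max {i. s i > 0}"

definition has_degree_sequence :: "plane_forest \<Rightarrow> (nat \<Rightarrow> nat) \<Rightarrow> bool" where
  "has_degree_sequence F s \<longleftrightarrow>
    (\<forall>i. (\<Sum>t\<leftarrow>F. card {v \<in> vertices t. vertex_degree t v = i}) = s i)"

text \<open>For a degree sequence \<open>s\<close> the set below is finite and nonempty, so this is the genuine
  uniform distribution.\<close>

definition uniform_forest :: "(nat \<Rightarrow> nat) \<Rightarrow> plane_forest pmf" where
  "uniform_forest s = pmf_of_set {F. has_degree_sequence F s}"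

definition empirical_degrees :: "(nat \<Rightarrow> nat) \<Rightarrow> nat \<Rightarrow> real" where
  "empirical_degrees s i = real (s i) / real (deg_seq_size s)"

text \<open>The series is a real one, so \<open>deg_sigma2 q\<close> and \<open>deg_sigma q\<close> have their intended meaning only when
  it is summable; finiteness of \<open>deg_sigma q\<close> has to be stated as summability.\<close>

definition deg_sigma2 :: "(nat \<Rightarrow> real) \<Rightarrow> real" where
  "deg_sigma2 q = (\<Sum>i. (real i)\<^sup>2 * q i) - 1"

definition deg_sigma :: "(nat \<Rightarrow> real) \<Rightarrow> real" where
  "deg_sigma q = sqrt (max 0 (deg_sigma2 q))"

text \<open>The depth-first word of degrees determines a plane tree; plane trees are compared
  lexicographically through it.\<close>

fun degree_word :: "plane_tree \<Rightarrow> nat list" where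
  "degree_word (PNode ts) = length ts # concat (map degree_word ts)"

text \<open>Since \<^const>\<open>sort_key\<close> is stable, this sorts by decreasing number of vertices, breaking ties
  by the lexicographic order of degree words and then by order of appearance.\<close>

definition ranked_trees :: "plane_forest \<Rightarrow> plane_tree list" where
  "ranked_trees F = sort_key (\<lambda>t. - int (card (vertices t))) (sort_key degree_word F)"

text \<open>A metric space is a carrier together with a distance; the root and the mass measure of the
  rescaled trees play no role for the diameter and are left out. Ranks \<open>l\<close> start at 1. A forest
  with degree sequence \<open>s\<close> consists of exactly \<open>deg_seq_trees s\<close> trees, so the second case below is
  \<open>l > deg_seq_trees s\<close>.\<close>

type_synonym 'a mspace_data = "'a set \<times> ('a \<Rightarrow> 'a \<Rightarrow> real)"

definition scaled_tree :: "(nat \<Rightarrow> nat) \<Rightarrow> plane_forest \<Rightarrow> nat \<Rightarrow> nat list mspace_data" where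
  "scaled_tree s F l =
    (if 1 \<le> l \<and> l \<le> length F then
       let t = ranked_trees F ! (l - 1) in
       (vertices t, \<lambda>u v. deg_sigma (empirical_degrees s) / (2 * sqrt (real (deg_seq_size s)))
                           * real (graph_dist t u v))
     else ({[]}, \<lambda>_ _. 0))"

definition diam :: "'a mspace_data \<Rightarrow> real" where
  "diam M = (SUP (x, y) \<in> fst M \<times> fst M. snd M x y)"

end

theory Submission
  imports Defs "HOL-Real_Asymp.Real_Asymp"
begin

text \<open>A tree of rank above \<open>j\<close> has at most \<open>n / (j + 1)\<close> vertices, so if its height exceeds \<open>b * sqrt n\<close>
  then the depth-first degree word contains a window of length at most \<open>n / (j + 1)\<close> in which a vertex
  has more than \<open>b * sqrt n\<close> ancestors. This event is invariant under rotating the word, so by the cycle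
  lemma its probability can be computed for a uniform arrangement of the degrees. There, the number
  of ancestors of the last vertex of a window of length \<open>t\<close> exceeds \<open>h\<close> with probability at most
  \<open>exp (- \<gamma> * h^2 / t)\<close>: by exchangeability this is bounded by the expected number of vertices at height
  \<open>h\<close> among the first \<open>t\<close> letters, and along the path to such a vertex the walk accumulates order
  \<open>h\<close> left siblings whose subtrees have to be exhausted within time \<open>t\<close>. Dyadic chaining makes the
  estimate uniform over a window, with probability \<open>O(1 / j^2)\<close>, and there are \<open>O(j)\<close> windows.\<close>

section \<open>Ancestral lines in degree words\<close>

text \<open>Being a forest word has probability of order n to the power -1/2, so bounding the event
  for arbitrary arrangements and dividing by that probability would lose a factor sqrt n; rotation
  invariance makes the conditioning free. Likewise, a union bound over all windows would cost a
  power of n, whereas the estimate for one window depends on j only: for h of order sqrt n and t of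
  order n / j the ratio h^2 / t is of order j. Hence the chaining. The total charge of the letters
  is of order sqrt n, and reading without replacement yields a drift of order sqrt n / j over one
  window. It is dominated by b * sqrt n only once j exceeds a constant; this, and windows being
  short compared with n, is the origin of the lower bounds on j. The constant \<open>\<eta>\<close>
  measures the share of letters of value at least 2: only they can contribute a left sibling to an
  ancestral line, and the limit law charges them because its \<open>deg_sigma\<close> is
  positive.\<close>

text \<open>Reading a degree word \<open>w\<close> as a piece of a depth-first search, \<open>spine w\<close> is the number of letters
  of \<open>w\<close> that are ancestors of the vertex visited just after \<open>w\<close>, and \<open>gap w\<close> is the depth of the
  minimum of the walk with steps \<open>d - 1\<close> below its start. Subtraction is truncated: the first letter
  of \<open>d # w\<close> is such an ancestor iff \<open>gap (d # w) = 0\<close>.\<close>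

fun gap :: "nat list \<Rightarrow> nat" where
  "gap [] = 0"
| "gap (d # w) = gap w + 1 - d"

fun spine :: "nat list \<Rightarrow> nat" where
  "spine [] = 0"
| "spine (d # w) = spine w + (if gap w < d then 1 else 0)"

text \<open>\<open>reads M h w\<close>: the word \<open>w\<close> consists of \<open>M\<close> complete trees followed by a path that descends
  \<open>h\<close> generations, where the existential chooses which child continues the path.\<close>

fun reads :: "nat \<Rightarrow> nat \<Rightarrow> nat list \<Rightarrow> bool" where
  "reads M h [] \<longleftrightarrow> M = 0 \<and> h = 0"
| "reads (Suc M) h (d # w) \<longleftrightarrow> reads (M + d) h w"
| "reads 0 0 (d # w) \<longleftrightarrow> False"
| "reads 0 (Suc h) (d # w) \<longleftrightarrow> (\<exists>i<d. reads i h w)"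

text \<open>The truncation in \<open>gap\<close> matches the two recursive clauses of
  \<open>reads\<close>: if \<open>gap w < d\<close>, the letter lies on the path and the witness for
  the existential is \<open>gap w\<close>, the number of children completed to its left; otherwise
  the letter belongs to a complete tree and all its d subtrees are exhausted within
  \<open>w\<close>.\<close>

lemma reads_gap_spine: "reads (gap w) (spine w) w"
proof (induction w)
  case (Cons d w)
  show ?case
  proof (cases "gap w < d")
    case True
    then have "gap w + 1 - d = 0" by simp
    then show ?thesis using Cons True by auto
  next
    case False
    then have "gap (d # w) = Suc (gap w - d)" by simp
    then show ?thesis using Cons False by simp
  qed
qed simp

lemma reads_imp_spine_ge: "reads M h w \<Longrightarrow> h \<le> spine w \<and> gap w \<le> M"
proof (induction M h w rule: reads.induct)
  case (4 h d w)
  then obtain i where "i < d" "reads i h w" by auto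
  then show ?case using 4(1)[of i] by force
qed force+

text \<open>Letters are dropped from the front until one more would leave fewer than h ancestors.
  The surviving first letter is then itself an ancestor, so \<open>gap\<close> vanishes there and
  \<open>reads_gap_spine\<close> applies; for h = 0 the empty suffix is reached.\<close>

lemma spine_imp_reads_suffix:
  assumes "h \<le> spine w"
  shows "\<exists>k\<le>length w. reads 0 h (drop k w)"
  using assms
proof (induction w)
  case Nil
  then show ?case by auto
next
  case (Cons d w)
  show ?case
  proof (cases "h \<le> spine w")
    case True
    then obtain k where "k \<le> length w" "reads 0 h (drop k w)" using Cons by auto
    then show ?thesis by (intro exI[of _ "Suc k"]) auto
  next
    case False
    then have "h = spine (d # w)" "gap (d # w) = 0" using Cons.prems by (auto split: if_splits)
    then show ?thesis using reads_gap_spine[of "d # w"] by (intro exI[of _ 0]) auto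
  qed
qed

lemma gap_append: "gap v \<le> gap (v @ w)"
  by (induction v) auto

text \<open>Appending letters can only raise \<open>gap\<close>, so it may close ancestors in
  \<open>v\<close> but never creates new ones there.\<close>

lemma spine_append_le: "spine (v @ w) \<le> spine v + spine w"
proof (induction v)
  case (Cons d v)
  then show ?case using gap_append[of v w] by auto
qed simp

lemma spine_append_ge: "spine w \<le> spine (v @ w)"
  by (induction v) auto

lemma spine_drop_le: "spine (drop k w) \<le> spine w"
  using spine_append_ge[of "drop k w" "take k w"] by simp

lemma reads_degree_word: "reads (Suc M) h (degree_word t @ w) = reads M h w"
proof (induction t arbitrary: M w)
  case (PNode ts)
  have "reads (M + length us) h (concat (map degree_word us) @ w) = reads M h w"
    if "set us \<subseteq> set ts" for us
    using that by (induction us) (auto simp: PNode)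
  then show ?case by simp
qed

definition forest_word :: "plane_forest \<Rightarrow> nat list" where
  "forest_word F = concat (map degree_word F)"

lemma forest_word_simps [simp]:
  "forest_word [] = []" "forest_word (t # F) = degree_word t @ forest_word F"
  "forest_word (F @ F') = forest_word F @ forest_word F'"
  by (simp_all add: forest_word_def)

lemma degree_word_PNode: "degree_word (PNode ts) = length ts # forest_word ts"
  by (simp add: forest_word_def)

declare degree_word.simps [simp del]

lemma reads_forest_word: "reads (M + length F) h (forest_word F @ w) = reads M h w"
  by (induction F) (auto simp: reads_degree_word)

text \<open>The prefix p consists of the letters visited before v in depth-first order: in each
  generation these are the parent on the path and the complete subtrees of the left siblings, as
  many as the address of v prescribes.\<close>

lemma vertex_imp_reads:
  assumes "v \<in> vertices t"
  shows "\<exists>p q. degree_word t = p @ q \<and> reads 0 (length v) p"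
  using assms
proof (induction t arbitrary: v)
  case (PNode ts)
  show ?case
  proof (cases v)
    case Nil
    then show ?thesis
      by (auto intro: exI[of _ "[]"] simp: Cons_eq_append_conv degree_word_PNode)
  next
    case (Cons i u)
    then have i: "i < length ts" and u: "u \<in> vertices (ts ! i)" using PNode.prems by auto
    then obtain p q where pq: "degree_word (ts ! i) = p @ q" "reads 0 (length u) p"
      using PNode.IH[OF nth_mem[OF i] u] by blast
    have ts: "ts = take i ts @ ts ! i # drop (Suc i) ts"
      using i by (rule id_take_nth_drop)
    have "degree_word (PNode ts) =
        (length ts # forest_word (take i ts) @ p) @ (q @ forest_word (drop (Suc i) ts))"
      using arg_cong[OF ts, of forest_word] by (simp add: degree_word_PNode pq)
    moreover have "reads i (length u) (forest_word (take i ts) @ p)"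
      using reads_forest_word[of 0 "take i ts" "length u" p] pq i by simp
    then have "reads 0 (length v) (length ts # forest_word (take i ts) @ p)"
      using i Cons by auto
    ultimately show ?thesis by blast
  qed
qed

section \<open>Plane forests as words\<close>

definition charge :: "nat list \<Rightarrow> int" where
  "charge w = (\<Sum>d\<leftarrow>w. 1 - int d)"

lemma charge_simps [simp]:
  "charge [] = 0" "charge (d # w) = 1 - int d + charge w" "charge (v @ w) = charge v + charge w"
  by (simp_all add: charge_def)

fun is_forest_word :: "nat list \<Rightarrow> bool" where
  "is_forest_word [] \<longleftrightarrow> True"
| "is_forest_word (d # w) \<longleftrightarrow> charge (d # w) > 0 \<and> is_forest_word w"

text \<open>Right-to-left evaluation of Polish notation: the trees parsed so far form a stack, and a
  letter d makes its top d entries the children of a new root. Positive charge of every nonempty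
  suffix guarantees that the stack never runs short.\<close>

fun parse :: "nat list \<Rightarrow> plane_forest" where
  "parse [] = []"
| "parse (d # w) = PNode (take d (parse w)) # drop d (parse w)"

lemma parse_forest_word:
  "is_forest_word w \<Longrightarrow> int (length (parse w)) = charge w \<and> forest_word (parse w) = w"
proof (induction w)
  case (Cons d w)
  then have *: "int (length (parse w)) = charge w" "forest_word (parse w) = w" "charge w \<ge> int d"
    by auto
  then have "d \<le> length (parse w)" by linarith
  then show ?case using * 
    by (auto simp: degree_word_PNode of_nat_diff simp flip: forest_word_simps(3))
qed simp

lemma parse_degree_word_append:
  "is_forest_word w \<Longrightarrow> is_forest_word (degree_word t @ w) \<and> parse (degree_word t @ w) = t # parse w"
proof (induction t arbitrary: w)
  case (PNode ts)
  have *: "is_forest_word (forest_word us @ w) \<and> parse (forest_word us @ w) = us @ parse w"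
    if "set us \<subseteq> set ts" for us
    using that by (induction us) (use PNode in auto)
  have "charge (forest_word ts @ w) \<ge> int (length ts)"
    using parse_forest_word[of "forest_word ts @ w"] *[of ts] by simp
  then show ?case using *[of ts] by (simp add: degree_word_PNode)
qed

lemma is_forest_word_forest_word:
  "is_forest_word (forest_word F) \<and> parse (forest_word F) = F"
  by (induction F) (auto simp: parse_degree_word_append)

lemma bij_betw_forest_word: "bij_betw forest_word UNIV {w. is_forest_word w}"
  by (rule bij_betw_byWitness[where f' = parse])
     (auto simp: is_forest_word_forest_word parse_forest_word)

lemma is_forest_word_iff:
  "is_forest_word w \<longleftrightarrow> (\<forall>k<length w. charge (drop k w) > 0)"
proof (induction w)
  case (Cons d w)
  show ?case unfolding is_forest_word.simps Cons length_Cons All_less_Suc2 drop_Suc_Cons drop_0 ..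
qed simp

section \<open>Degrees of vertices and letters of the degree word\<close>

lemma Nil_in_vertices [simp]: "[] \<in> vertices t"
  by (cases t) auto

lemma Cons_in_vertices [simp]:
  "i # v \<in> vertices (PNode ts) \<longleftrightarrow> i < length ts \<and> v \<in> vertices (ts ! i)"
  by (simp add: image_iff)

lemma finite_vertices [simp]: "finite (vertices t)"
proof (induction t)
  case (PNode ts)
  then have "finite (vertices (ts ! i))" if "i < length ts" for i
    using that by simp
  then show ?case by simp
qed

lemma vertex_degree_Nil: "vertex_degree (PNode ts) [] = length ts"
proof -
  have "{i. [] @ [i] \<in> vertices (PNode ts)} = {..<length ts}"
    by (auto simp del: vertices.simps)
  then show ?thesis unfolding vertex_degree_def by simp
qed

lemma vertex_degree_Cons:
  "i < length ts \<Longrightarrow> vertex_degree (PNode ts) (i # v) = vertex_degree (ts ! i) v"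
  unfolding vertex_degree_def by (simp del: vertices.simps)

lemma card_vertices_split:
  "card {v \<in> vertices (PNode ts). P v} =
     (if P [] then 1 else 0) + (\<Sum>i<length ts. card {v \<in> vertices (ts ! i). P (i # v)})"
proof -
  have "{v \<in> vertices (PNode ts). P v} = (if P [] then {[]} else {}) \<union>
      (\<Union>i<length ts. (#) i ` {v \<in> vertices (ts ! i). P (i # v)})"
    by auto
  also have "card \<dots> = card (if P [] then {[]} else {} :: nat list set) +
      card (\<Union>i<length ts. (#) i ` {v \<in> vertices (ts ! i). P (i # v)})"
    by (intro card_Un_disjoint) auto
  also have "card (\<Union>i<length ts. (#) i ` {v \<in> vertices (ts ! i). P (i # v)}) =
      (\<Sum>i<length ts. card ((#) i ` {v \<in> vertices (ts ! i). P (i # v)}))"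
    by (intro card_UN_disjoint) auto
  also have "\<dots> = (\<Sum>i<length ts. card {v \<in> vertices (ts ! i). P (i # v)})"
    by (intro sum.cong refl card_image) auto
  finally show ?thesis by simp
qed

lemma count_mset_forest_word:
  "count (mset (forest_word F)) i = (\<Sum>t\<leftarrow>F. count (mset (degree_word t)) i)"
  by (induction F) auto

lemma card_vertices_degree:
  "card {v \<in> vertices t. vertex_degree t v = i} = count (mset (degree_word t)) i"
proof (induction t)
  case (PNode ts)
  have "(\<Sum>j<length ts. card {v \<in> vertices (ts ! j). vertex_degree (PNode ts) (j # v) = i}) =
      (\<Sum>j<length ts. count (mset (degree_word (ts ! j))) i)"
    using PNode by (intro sum.cong refl) (auto simp: vertex_degree_Cons)
  also have "\<dots> = count (mset (forest_word ts)) i"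
    unfolding count_mset_forest_word by (simp add: sum_list_sum_nth atLeast0LessThan)
  finally show ?case
    by (subst card_vertices_split) (simp add: vertex_degree_Nil degree_word_PNode)
qed

lemma card_vertices: "card (vertices t) = length (degree_word t)"
proof (induction t)
  case (PNode ts)
  have "(\<Sum>j<length ts. card (vertices (ts ! j))) = length (forest_word ts)"
    using PNode
    by (simp add: sum_list_sum_nth atLeast0LessThan forest_word_def length_concat)
  moreover have "card (vertices (PNode ts)) = card {v \<in> vertices (PNode ts). True}"
    by (simp del: vertices.simps)
  ultimately show ?case
    by (simp only: card_vertices_split) (simp add: degree_word_PNode)
qed

lemma has_degree_sequence_iff:
  "has_degree_sequence F s \<longleftrightarrow> (\<forall>i. count (mset (forest_word F)) i = s i)"
  unfolding has_degree_sequence_def card_vertices_degree count_mset_forest_word ..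

section \<open>Averages over arrangements of a multiset\<close>

definition perm_avg :: "'a multiset \<Rightarrow> ('a list \<Rightarrow> real) \<Rightarrow> real" where
  "perm_avg A f =
     (\<Sum>w\<in>permutations_of_multiset A. f w) / real (card (permutations_of_multiset A))"

lemma sum_count_eq_sum_mset:
  "(\<Sum>x\<in>set_mset A. real (count A x) * f x) = (\<Sum>x\<in>#A. f x)"
proof (induction A)
  case (add y A)
  have "(\<Sum>x\<in>set_mset (add_mset y A). real (count (add_mset y A) x) * f x) =
      (\<Sum>x\<in>insert y (set_mset A). real (count A x) * f x + (if x = y then f x else 0))"
    by (intro sum.cong) (auto simp: algebra_simps)
  also have "\<dots> = (\<Sum>x\<in>insert y (set_mset A). real (count A x) * f x) + f y"
    by (simp add: sum.distrib)
  also have "(\<Sum>x\<in>insert y (set_mset A). real (count A x) * f x) =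
      (\<Sum>x\<in>set_mset A. real (count A x) * f x)"
    by (intro sum.mono_neutral_right) (auto simp: not_in_iff)
  finally show ?case using add by simp
qed simp

lemma perm_avg_mono:
  "(\<And>w. mset w = A \<Longrightarrow> f w \<le> g w) \<Longrightarrow> perm_avg A f \<le> perm_avg A g"
  unfolding perm_avg_def
  by (intro divide_right_mono sum_mono) (auto simp: permutations_of_multiset_def)

lemma perm_avg_cong:
  "(\<And>w. mset w = A \<Longrightarrow> f w = g w) \<Longrightarrow> perm_avg A f = perm_avg A g"
  by (intro antisym perm_avg_mono) auto

lemma perm_avg_const [simp]: "perm_avg A (\<lambda>_. c) = c"
  by (simp add: perm_avg_def card_gt_0_iff)

lemma perm_avg_sum: "perm_avg A (\<lambda>w. \<Sum>i\<in>I. f i w) = (\<Sum>i\<in>I. perm_avg A (f i))"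
  unfolding perm_avg_def by (subst sum.swap) (simp add: sum_divide_distrib)

lemma mset_rotate [simp]: "mset (rotate m w) = mset w"
  by (simp add: rotate_drop_take) (metis append_take_drop_id mset_append union_commute)

lemma perm_avg_rotate: "perm_avg A (\<lambda>w. f (rotate m w)) = perm_avg A f"
proof -
  have "inj_on (rotate m) (permutations_of_multiset A)"
    using inj_fn[OF inj_rotate1, of m] unfolding rotate_def by (rule inj_on_subset) simp
  moreover have "rotate m ` permutations_of_multiset A \<subseteq> permutations_of_multiset A"
    by (auto simp: permutations_of_multiset_def)
  ultimately have "bij_betw (rotate m) (permutations_of_multiset A) (permutations_of_multiset A)"
    by (simp add: bij_betw_def endo_inj_surj)
  then have "(\<Sum>w\<in>permutations_of_multiset A. f (rotate m w)) = (\<Sum>w\<in>permutations_of_multiset A. f w)"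
    by (rule sum.reindex_bij_betw)
  then show ?thesis by (simp add: perm_avg_def)
qed

text \<open>The share of arrangements that start with d is proportional to the multiplicity of d, so
  the first letter is a uniform element of the multiset and the rest is a uniform arrangement of
  what remains.\<close>

lemma perm_avg_step:
  assumes "A \<noteq> {#}"
  shows "perm_avg A f = (\<Sum>d\<in>#A. perm_avg (A - {#d#}) (\<lambda>w. f (d # w))) / real (size A)"
proof -
  let ?P = permutations_of_multiset
  have pos: "real (card (?P B)) > 0" for B :: "'a multiset"
    by (simp add: card_gt_0_iff)
  have "(\<Sum>w\<in>?P A. f w) = (\<Sum>d\<in>set_mset A. \<Sum>w\<in>(#) d ` ?P (A - {#d#}). f w)"
    unfolding permutations_of_multiset_nonempty[OF assms] by (subst sum.UNION_disjoint) auto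
  also have "\<dots> = (\<Sum>d\<in>set_mset A. \<Sum>w\<in>?P (A - {#d#}). f (d # w))"
    by (rule sum.cong[OF refl], subst sum.reindex) (simp_all add: o_def)
  also have "\<dots> = (\<Sum>d\<in>set_mset A. real (count A d) *
      (perm_avg (A - {#d#}) (\<lambda>w. f (d # w)) * real (card (?P A)) / real (size A)))"
  proof (intro sum.cong refl)
    fix d assume d: "d \<in># A"
    have "(\<Sum>w\<in>?P (A - {#d#}). f (d # w)) =
        perm_avg (A - {#d#}) (\<lambda>w. f (d # w)) * real (card (?P (A - {#d#})))"
      using pos[of "A - {#d#}"] by (simp add: perm_avg_def)
    then show "(\<Sum>w\<in>?P (A - {#d#}). f (d # w)) = real (count A d) *
      (perm_avg (A - {#d#}) (\<lambda>w. f (d # w)) * real (card (?P A)) / real (size A))"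
      using d by (simp add: real_card_permutations_of_multiset_remove)
  qed
  also have "\<dots> = (\<Sum>d\<in>#A. perm_avg (A - {#d#}) (\<lambda>w. f (d # w)) *
      (real (card (?P A)) / real (size A)))"
    by (subst sum_count_eq_sum_mset) simp
  also have "\<dots> = (\<Sum>d\<in>#A. perm_avg (A - {#d#}) (\<lambda>w. f (d # w))) *
      (real (card (?P A)) / real (size A))"
    by (rule sum_mset_distrib_right[symmetric])
  finally show ?thesis using pos[of A] by (simp add: perm_avg_def[of A])
qed

section \<open>The expected number of vertices at a given height\<close>

text \<open>\<open>visits 0 h t w\<close> bounds the number of vertices of height \<open>h\<close> with depth-first index at most
  \<open>t\<close> in the tree coded by \<open>w\<close>.\<close>

fun visits :: "nat \<Rightarrow> nat \<Rightarrow> nat \<Rightarrow> nat list \<Rightarrow> real" where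
  "visits 0 0 t w = 1"
| "visits (Suc M) h (Suc t) (d # w) = visits (M + d) h t w"
| "visits 0 (Suc h) (Suc t) (d # w) = (\<Sum>i<d. visits i h t w)"
| "visits _ _ _ _ = 0"

lemma Collect_le_Suc_split:
  "{k. k \<le> Suc t \<and> P k} = (if P 0 then {0} else {}) \<union> Suc ` {k. k \<le> t \<and> P (Suc k)}"
proof (intro equalityI subsetI)
  fix k assume "k \<in> {k. k \<le> Suc t \<and> P k}"
  then show "k \<in> (if P 0 then {0} else {}) \<union> Suc ` {k. k \<le> t \<and> P (Suc k)}"
    by (cases k) auto
qed (auto split: if_splits)

lemma card_reads_le_visits:
  "t \<le> length w \<Longrightarrow> real (card {k. k \<le> t \<and> reads M h (take k w)}) \<le> visits M h t w"
proof (induction M h t w rule: visits.induct)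
  case (1 t w)
  have "{k. k \<le> t \<and> reads 0 0 (take k w)} \<subseteq> {0}"
  proof
    fix k assume k: "k \<in> {k. k \<le> t \<and> reads 0 0 (take k w)}"
    then have "take k w = []" by (cases "take k w") auto
    then show "k \<in> {0}" using k 1 by auto
  qed
  from card_mono[OF _ this] show ?case by simp
next
  case (2 M h t d w)
  then show ?case by (simp add: Collect_le_Suc_split card_image)
next
  case (3 h t d w)
  have "card {k. k \<le> t \<and> (\<exists>i<d. reads i h (take k w))} \<le>
      card (\<Union>i<d. {k. k \<le> t \<and> reads i h (take k w)})"
    by (intro card_mono) auto
  also have "\<dots> \<le> (\<Sum>i<d. card {k. k \<le> t \<and> reads i h (take k w)})"
    by (intro card_UN_le) auto
  finally have "real (card {k. k \<le> t \<and> (\<exists>i<d. reads i h (take k w))}) \<le>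
      (\<Sum>i<d. real (card {k. k \<le> t \<and> reads i h (take k w)}))"
    by (simp flip: of_nat_sum)
  also have "\<dots> \<le> (\<Sum>i<d. visits i h t w)"
    using 3 by (intro sum_mono) auto
  finally show ?case by (simp add: Collect_le_Suc_split card_image)
qed auto

section \<open>Exponential estimates for a single letter\<close>

definition mset_charge :: "nat multiset \<Rightarrow> real" where
  "mset_charge A = (\<Sum>d\<in>#A. 1 - real d)"

text \<open>The walk goes down by at most one per step but can jump up arbitrarily far, so y is
  bounded from below only. For positive y the bound follows from
  \<open>exp y \<ge> 1 + y\<close>.\<close>

lemma exp_minus_le_quadratic:
  fixes y :: real
  assumes "-1 \<le> y"
  shows "exp (- y) \<le> 1 - y + y\<^sup>2"
proof (cases "y \<ge> 0")
  case True
  have "exp (-y) = 1 / exp y" by (simp add: exp_minus field_simps)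
  also have "\<dots> \<le> 1 / (1 + y)"
    using True exp_ge_add_one_self[of y] by (intro divide_left_mono) auto
  also have "\<dots> \<le> 1 - y + y\<^sup>2"
  proof -
    have "(1 - y + y\<^sup>2) * (1 + y) = 1 + y ^ 3"
      by (simp add: algebra_simps power2_eq_square power3_eq_cube)
    then show ?thesis using True by (simp add: divide_le_eq)
  qed
  finally show ?thesis .
next
  case False
  then show ?thesis using assms exp_bound[of "-y"] by simp
qed

lemma sum_exp_step_le:
  assumes "0 \<le> x" "x \<le> 1"
  shows "(\<Sum>d\<in>#A. exp (- x * (real d - 1))) \<le>
    real (size A) + x * mset_charge A + x\<^sup>2 * (\<Sum>d\<in>#A. (real d)\<^sup>2 + 1)"
proof -
  have "exp (- x * (real d - 1)) \<le> 1 + (x * (1 - real d) + x\<^sup>2 * ((real d)\<^sup>2 + 1))" for d :: nat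
  proof -
    have "-1 \<le> x * (real d - 1)"
      using mult_left_mono[of "-1" "real d - 1" x] assms by simp
    from exp_minus_le_quadratic[OF this]
    have "exp (- x * (real d - 1)) \<le> 1 + x * (1 - real d) + x\<^sup>2 * (real d - 1)\<^sup>2"
      by (simp add: power_mult_distrib[symmetric] right_diff_distrib)
    also have "x\<^sup>2 * (real d - 1)\<^sup>2 \<le> x\<^sup>2 * ((real d)\<^sup>2 + 1)"
      by (intro mult_left_mono) (auto simp: power2_eq_square algebra_simps)
    finally show ?thesis by simp
  qed
  then have "(\<Sum>d\<in>#A. exp (- x * (real d - 1))) \<le>
      (\<Sum>d\<in>#A. 1 + (x * (1 - real d) + x\<^sup>2 * ((real d)\<^sup>2 + 1)))"
    by (intro sum_mset_mono)
  also have "\<dots> = real (size A) + (x * mset_charge A + x\<^sup>2 * (\<Sum>d\<in>#A. (real d)\<^sup>2 + 1))"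
    unfolding mset_charge_def by (simp add: sum_mset.distrib sum_mset_distrib_left[symmetric])
  finally show ?thesis by simp
qed

text \<open>This is the weight of a letter on the ancestral line: i counts the left siblings still
  to be exhausted, each penalised by \<open>exp (- \<alpha>)\<close>, and the first factor records
  the change in the charge of the remaining letters. The gain \<open>\<alpha> / 2\<close> comes from
  the single choice i = 1, available once d is at least 2.\<close>

lemma exp_times_geometric_le:
  fixes \<alpha> \<theta> :: real
  assumes "0 \<le> \<alpha>" "\<alpha> \<le> 1" "0 \<le> \<theta>" "\<theta> * real d \<le> 1"
  shows "exp (\<theta> * (real d - 1)) * (\<Sum>i<d. exp (- \<alpha> * real i)) \<le>
    real d + 2 * \<theta> * (real d)\<^sup>2 - (if 2 \<le> d then \<alpha> / 2 else 0)"
proof -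
  consider "d = 0" | "d = 1" | "d \<ge> 2" by linarith
  then show ?thesis
  proof cases
    case 3
    define e where "e = d - 2"
    have d: "d = Suc (Suc e)" using 3 by (simp add: e_def)
    have "exp (- \<alpha>) = 1 / exp \<alpha>" by (simp add: exp_minus field_simps)
    also have "\<dots> \<le> 1 / (1 + \<alpha>)"
      using assms exp_ge_add_one_self[of \<alpha>] by (intro divide_left_mono) auto
    also have "\<dots> \<le> 1 - \<alpha> / 2"
      using assms mult_left_mono[of \<alpha> 1 \<alpha>] by (simp add: field_simps)
    finally have e1: "exp (- \<alpha>) \<le> 1 - \<alpha> / 2" .
    have "(\<Sum>i<d. exp (- \<alpha> * real i)) = 1 + exp (- \<alpha>) + (\<Sum>i<e. exp (- \<alpha> * real (Suc (Suc i))))"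
      unfolding d by (simp only: sum.lessThan_Suc_shift) simp
    also have "(\<Sum>i<e. exp (- \<alpha> * real (Suc (Suc i)))) \<le> (\<Sum>i<e. 1)"
      using assms by (intro sum_mono) simp
    finally have geo: "(\<Sum>i<d. exp (- \<alpha> * real i)) \<le> real d - \<alpha> / 2"
      using e1 by (simp add: d)
    have x: "0 \<le> \<theta> * (real d - 1)" "\<theta> * (real d - 1) \<le> 1"
      using assms 3 mult_left_mono[of "real d - 1" "real d" \<theta>] by auto
    have "exp (\<theta> * (real d - 1)) \<le> 1 + \<theta> * (real d - 1) + (\<theta> * (real d - 1))\<^sup>2"
      using x by (rule exp_bound)
    also have "(\<theta> * (real d - 1))\<^sup>2 \<le> \<theta> * (real d - 1)"
      using x mult_left_mono[of "\<theta> * (real d - 1)" 1 "\<theta> * (real d - 1)"] by (simp add: power2_eq_square)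
    finally have ex: "exp (\<theta> * (real d - 1)) \<le> 1 + 2 * (\<theta> * (real d - 1))" by simp
    have "exp (\<theta> * (real d - 1)) * (\<Sum>i<d. exp (- \<alpha> * real i)) \<le>
        (1 + 2 * (\<theta> * (real d - 1))) * (real d - \<alpha> / 2)"
      using ex geo x by (intro mult_mono) (auto intro: sum_nonneg)
    also have "\<dots> = real d - \<alpha> / 2 + 2 * \<theta> * (real d)\<^sup>2 - (2 * \<theta> * real d + \<theta> * (real d - 1) * \<alpha>)"
      by (simp add: algebra_simps power2_eq_square)
    also have "\<dots> \<le> real d - \<alpha> / 2 + 2 * \<theta> * (real d)\<^sup>2"
      using mult_nonneg_nonneg[OF x(1) assms(1)]
        mult_nonneg_nonneg[OF assms(3) of_nat_0_le_iff[of d]]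
      unfolding mult.assoc by linarith
    finally show ?thesis using 3 by simp
  qed (use assms in auto)
qed

lemma sum_spine_step_le:
  fixes \<alpha> \<theta> :: real
  assumes "0 \<le> \<alpha>" "\<alpha> \<le> 1" "0 \<le> \<theta>" "\<And>d. d \<in># A \<Longrightarrow> \<theta> * real d \<le> 1"
  shows "(\<Sum>d\<in>#A. exp (\<theta> * (real d - 1)) * (\<Sum>i<d. exp (- \<alpha> * real i))) \<le>
    real (size A) - mset_charge A + 2 * \<theta> * (\<Sum>d\<in>#A. (real d)\<^sup>2 + 1)
      - \<alpha> / 2 * real (size (filter_mset (\<lambda>d. 2 \<le> d) A))"
  using assms(4)
proof (induction A)
  case (add d A)
  have "exp (\<theta> * (real d - 1)) * (\<Sum>i<d. exp (- \<alpha> * real i)) \<le>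
    real d + 2 * \<theta> * (real d)\<^sup>2 - (if 2 \<le> d then \<alpha> / 2 else 0)"
    by (intro exp_times_geometric_le assms(1-3) add.prems) simp
  moreover have "(\<Sum>d\<in>#A. exp (\<theta> * (real d - 1)) * (\<Sum>i<d. exp (- \<alpha> * real i))) \<le>
    real (size A) - mset_charge A + 2 * \<theta> * (\<Sum>d\<in>#A. (real d)\<^sup>2 + 1)
      - \<alpha> / 2 * real (size (filter_mset (\<lambda>d. 2 \<le> d) A))"
    by (intro add.IH add.prems) simp
  ultimately show ?case using assms(3)
    by (auto simp: mset_charge_def ring_distribs add_divide_distrib)
qed (simp add: mset_charge_def)


text \<open>The right-hand side is a supersolution of the one-step recursion for the left-hand side. The
  term \<open>2 * \<alpha> * t / n * mset_charge A\<close> absorbs the drift of the walk without replacement; it works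
  because \<open>mset_charge A - M\<close> never decreases, so that the charge of the remaining letters stays
  non-negative.\<close>

lemma perm_avg_visits_le:
  fixes \<alpha> \<eta> B n :: real
  assumes \<alpha>: "0 \<le> \<alpha>" "\<alpha> \<le> 1" and n: "0 < n" and \<eta>: "0 \<le> \<eta>"
    and "n / 2 + real t \<le> real (size A)" "real (size A) \<le> n"
    and "\<eta> * n + real t \<le> real (size (filter_mset (\<lambda>d. 2 \<le> d) A))"
    and "(\<Sum>d\<in>#A. (real d)\<^sup>2 + 1) \<le> B * n"
    and "\<And>d. d \<in># A \<Longrightarrow> 2 * \<alpha> * real t * real d \<le> n"
    and "16 * B * real t \<le> \<eta> * n"
    and "real M \<le> mset_charge A"
  shows "perm_avg A (visits M h t) \<le>
    exp (- \<alpha> * real M + 2 * \<alpha> * real t / n * mset_charge A + 2 * B * \<alpha>\<^sup>2 * real t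
      - \<eta> * \<alpha> / 4 * real h)"
  using assms(5-)
proof (induction t arbitrary: A M h)
  case 0
  have "visits M h 0 w = (if M = 0 \<and> h = 0 then 1 else 0)" for w
    by (cases M; cases h) auto
  then have "visits M h 0 = (\<lambda>_. if M = 0 \<and> h = 0 then 1 else 0)" by blast
  then show ?case by simp
next
  case (Suc t)
  define m where "m = real (size A)"
  define c where "c = mset_charge A"
  define S where "S = (\<Sum>d\<in>#A. (real d)\<^sup>2 + 1)"
  define \<theta> where "\<theta> = 2 * \<alpha> * real t / n"
  define K where "K = \<theta> * c + 2 * B * \<alpha>\<^sup>2 * real t"
  have m: "m > 0" "m \<ge> n / 2" "m \<le> n" using Suc.prems(1,2) n by (auto simp: m_def)
  have A: "A \<noteq> {#}" using m by (auto simp: m_def)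
  have c: "c \<ge> real M" "c \<ge> 0" using Suc.prems(7) by (auto simp: c_def)
  have "(\<Sum>d\<in>#A. 0) \<le> S" unfolding S_def by (intro sum_mset_mono) simp
  then have S: "0 \<le> S" "S \<le> B * n" using Suc.prems(4) by (auto simp: S_def)
  have B: "B \<ge> 0" using S n by (metis mult_less_0_iff not_less order_trans)
  have \<theta>: "0 \<le> \<theta>" using \<alpha> n by (simp add: \<theta>_def)
  have \<theta>d: "\<theta> * real d \<le> 1" if "d \<in># A" for d
  proof -
    have "2 * \<alpha> * real t * real d \<le> 2 * \<alpha> * real (Suc t) * real d"
      using \<alpha> by (intro mult_right_mono mult_left_mono) auto
    also have "\<dots> \<le> n" using Suc.prems(5) that by blast
    finally show ?thesis using n by (simp add: \<theta>_def divide_le_eq)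
  qed
  have IH: "perm_avg (A - {#d#}) (visits M' h' t) \<le>
      exp (- \<alpha> * real M' + \<theta> * (c + real d - 1) + 2 * B * \<alpha>\<^sup>2 * real t - \<eta> * \<alpha> / 4 * real h')"
    if d: "d \<in># A" and M': "real M' \<le> c + real d - 1" for d M' h'
  proof -
    obtain A' where A': "A = add_mset d A'" using d by (metis multi_member_split)
    have c': "mset_charge A' = c + real d - 1"
      by (simp add: c_def A' mset_charge_def)
    have "perm_avg A' (visits M' h' t) \<le>
      exp (- \<alpha> * real M' + 2 * \<alpha> * real t / n * mset_charge A' + 2 * B * \<alpha>\<^sup>2 * real t
        - \<eta> * \<alpha> / 4 * real h')"
    proof (rule Suc.IH)
      show "n / 2 + real t \<le> real (size A')" "real (size A') \<le> n"
        "\<eta> * n + real t \<le> real (size (filter_mset (\<lambda>d. 2 \<le> d) A'))"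
        using Suc.prems(1-3) by (auto simp: A' split: if_splits)
      show "(\<Sum>d\<in>#A'. (real d)\<^sup>2 + 1) \<le> B * n"
        using Suc.prems(4) unfolding A' by (simp add: add_nonneg_nonneg) (smt (verit) zero_le_power2)
      show "2 * \<alpha> * real t * real e \<le> n" if "e \<in># A'" for e
        using \<theta>d[of e] that n by (simp add: A' \<theta>_def divide_le_eq)
      have "16 * B * real t \<le> 16 * B * real (Suc t)" using B by (intro mult_left_mono) auto
      then show "16 * B * real t \<le> \<eta> * n" using Suc.prems(6) by linarith
      show "real M' \<le> mset_charge A'" using M' c' by simp
    qed
    then show ?thesis by (simp add: A' c' \<theta>_def)
  qed
  show ?case
  proof (cases M)
    case (Suc M0)
    have visits: "(\<lambda>w. visits M h (Suc t) (d # w)) = visits (M0 + d) h t" for d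
      by (simp add: Suc)
    define E where "E = exp (- \<alpha> * real M + K - \<eta> * \<alpha> / 4 * real h)"
    \<comment> \<open>Reading d changes the number of pending trees and the charge of the remaining
      letters by the same amount d - 1, so the exponent changes by
      \<open>- (\<alpha> - \<theta>) * (d - 1)\<close>.\<close>
    define x where "x = \<alpha> - \<theta>"
    have x: "0 \<le> x" "x \<le> \<alpha>"
    proof -
      have "2 * real t \<le> n" using Suc.prems(1,2) by simp
      then have "2 * \<alpha> * real t \<le> \<alpha> * n"
        using mult_left_mono[of "2 * real t" n \<alpha>] \<alpha> by simp
      then show "0 \<le> x" using n by (simp add: x_def \<theta>_def divide_le_eq)
    qed (use \<theta> in \<open>simp add: x_def\<close>)
    have "perm_avg A (visits M h (Suc t)) =
        (\<Sum>d\<in>#A. perm_avg (A - {#d#}) (visits (M0 + d) h t)) / m"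
      by (subst perm_avg_step[OF A]) (simp add: visits m_def)
    also have "\<dots> \<le> (\<Sum>d\<in>#A. E * exp (- x * (real d - 1))) / m"
    proof (intro divide_right_mono sum_mset_mono)
      fix d assume "d \<in># A"
      then have "perm_avg (A - {#d#}) (visits (M0 + d) h t) \<le>
          exp (- \<alpha> * real (M0 + d) + \<theta> * (c + real d - 1) + 2 * B * \<alpha>\<^sup>2 * real t
            - \<eta> * \<alpha> / 4 * real h)"
        using c(1) by (intro IH) (auto simp: Suc)
      also have "\<dots> = E * exp (- x * (real d - 1))"
        unfolding E_def K_def x_def Suc by (simp flip: exp_add add: algebra_simps)
      finally show "perm_avg (A - {#d#}) (visits (M0 + d) h t) \<le> E * exp (- x * (real d - 1))" .
    qed (use m in simp)
    also have "\<dots> = E * ((\<Sum>d\<in>#A. exp (- x * (real d - 1))) / m)"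
      by (simp add: sum_mset_distrib_left)
    also have "\<dots> \<le> E * exp (2 * \<alpha> / n * c + 2 * B * \<alpha>\<^sup>2)"
    proof (intro mult_left_mono)
      have "(\<Sum>d\<in>#A. exp (- x * (real d - 1))) \<le> m + x * c + x\<^sup>2 * S"
        using sum_exp_step_le[of x A] x \<alpha> by (simp add: m_def c_def S_def)
      also have "\<dots> \<le> m + \<alpha> * c + \<alpha>\<^sup>2 * (B * n)"
        using x c S \<alpha> by (intro add_mono mult_mono mult_right_mono power_mono) auto
      \<comment> \<open>At least n / 2 letters remain, which is the origin of both factors 2; the
        bracket is exactly the growth of the exponent from \<open>t\<close> to
        \<open>Suc t\<close>.\<close>
      also have "\<dots> = m + (2 * \<alpha> / n * c + 2 * B * \<alpha>\<^sup>2) * (n / 2)"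
        using n by (simp add: field_simps)
      also have "\<dots> \<le> m + (2 * \<alpha> / n * c + 2 * B * \<alpha>\<^sup>2) * m"
        using m n \<alpha> c B by (intro add_left_mono mult_left_mono) auto
      finally have "(\<Sum>d\<in>#A. exp (- x * (real d - 1))) / m \<le> 1 + (2 * \<alpha> / n * c + 2 * B * \<alpha>\<^sup>2)"
        using m by (simp add: field_simps)
      also have "\<dots> \<le> exp (2 * \<alpha> / n * c + 2 * B * \<alpha>\<^sup>2)" by (rule exp_ge_add_one_self)
      finally show "(\<Sum>d\<in>#A. exp (- x * (real d - 1))) / m \<le> exp (2 * \<alpha> / n * c + 2 * B * \<alpha>\<^sup>2)" .
    qed (simp add: E_def)
    also have "\<dots> = exp (- \<alpha> * real M + 2 * \<alpha> * real (Suc t) / n * c + 2 * B * \<alpha>\<^sup>2 * real (Suc t)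
      - \<eta> * \<alpha> / 4 * real h)"
      unfolding E_def K_def \<theta>_def exp_add[symmetric]
      by (rule arg_cong[of _ _ exp]) (simp add: algebra_simps add_divide_distrib)
    finally show ?thesis by (simp add: c_def)
  next
    case 0
    show ?thesis
    proof (cases h)
      case 0
      have "visits M h (Suc t) = (\<lambda>_. 1)" by (auto simp: \<open>M = 0\<close> 0)
      then show ?thesis using \<alpha> c n B by (simp add: \<open>M = 0\<close> 0 c_def)
    next
      case (Suc h0)
      define E where "E = exp (K - \<eta> * \<alpha> / 4 * real h0)"
      have visits: "(\<lambda>w. visits M h (Suc t) (d # w)) = (\<lambda>w. \<Sum>i<d. visits i h0 t w)" for d
        by (simp add: \<open>M = 0\<close> Suc)
      have "perm_avg A (visits M h (Suc t)) =
          (\<Sum>d\<in>#A. \<Sum>i<d. perm_avg (A - {#d#}) (visits i h0 t)) / m"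
        by (subst perm_avg_step[OF A]) (simp add: visits m_def perm_avg_sum)
      also have "\<dots> \<le> (\<Sum>d\<in>#A. E * (exp (\<theta> * (real d - 1)) * (\<Sum>i<d. exp (- \<alpha> * real i)))) / m"
      proof (intro divide_right_mono sum_mset_mono)
        fix d assume d: "d \<in># A"
        have "(\<Sum>i<d. perm_avg (A - {#d#}) (visits i h0 t)) \<le>
            (\<Sum>i<d. E * (exp (\<theta> * (real d - 1)) * exp (- \<alpha> * real i)))"
        proof (intro sum_mono)
          fix i assume "i \<in> {..<d}"
          then have "perm_avg (A - {#d#}) (visits i h0 t) \<le>
              exp (- \<alpha> * real i + \<theta> * (c + real d - 1) + 2 * B * \<alpha>\<^sup>2 * real t
                - \<eta> * \<alpha> / 4 * real h0)"
            using c(2) d by (intro IH) auto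
          also have "\<dots> = E * (exp (\<theta> * (real d - 1)) * exp (- \<alpha> * real i))"
            unfolding E_def K_def by (simp flip: exp_add add: algebra_simps)
          finally show "perm_avg (A - {#d#}) (visits i h0 t) \<le>
            E * (exp (\<theta> * (real d - 1)) * exp (- \<alpha> * real i))" .
        qed
        then show "(\<Sum>i<d. perm_avg (A - {#d#}) (visits i h0 t)) \<le>
            E * (exp (\<theta> * (real d - 1)) * (\<Sum>i<d. exp (- \<alpha> * real i)))"
          by (simp add: sum_distrib_left)
      qed (use m in simp)
      also have "\<dots> = E * ((\<Sum>d\<in>#A. exp (\<theta> * (real d - 1)) * (\<Sum>i<d. exp (- \<alpha> * real i))) / m)"
        by (simp add: sum_mset_distrib_left)
      also have "\<dots> \<le> E * exp (- (\<eta> * \<alpha> / 4))"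
      proof (intro mult_left_mono)
        have "(\<Sum>d\<in>#A. exp (\<theta> * (real d - 1)) * (\<Sum>i<d. exp (- \<alpha> * real i))) \<le>
            m - c + 2 * \<theta> * S - \<alpha> / 2 * real (size (filter_mset (\<lambda>d. 2 \<le> d) A))"
          using sum_spine_step_le[OF \<alpha> \<theta> \<theta>d] by (simp add: m_def c_def S_def)
        also have "\<dots> \<le> m - 0 + 2 * \<theta> * (B * n) - \<alpha> / 2 * (\<eta> * n)"
          using \<theta> S c \<alpha> Suc.prems(3)
          by (intro add_mono diff_mono mult_left_mono) auto
        \<comment> \<open>Letters of value at least 2 gain
          \<open>\<alpha> / 2 * (\<eta> * n)\<close>. Half of it pays for this term, by
          \<open>16 * B * t \<le> \<eta> * n\<close>; the other half is the price of one
          generation.\<close>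
        also have "2 * \<theta> * (B * n) = \<alpha> / 4 * (16 * B * real t)"
          using n by (simp add: \<theta>_def)
        also have "\<dots> \<le> \<alpha> / 4 * (\<eta> * n)"
        proof (intro mult_left_mono)
          have "16 * B * real t \<le> 16 * B * real (Suc t)" using B by (intro mult_left_mono) auto
          then show "16 * B * real t \<le> \<eta> * n" using Suc.prems(6) by linarith
        qed (use \<alpha> in simp)
        finally have "(\<Sum>d\<in>#A. exp (\<theta> * (real d - 1)) * (\<Sum>i<d. exp (- \<alpha> * real i))) \<le>
            m - \<eta> * \<alpha> / 4 * n"
          by (simp add: algebra_simps)
        also have "\<dots> \<le> m - \<eta> * \<alpha> / 4 * m"
          using m \<alpha> \<eta> by (intro diff_left_mono mult_left_mono) auto
        finally have "(\<Sum>d\<in>#A. exp (\<theta> * (real d - 1)) * (\<Sum>i<d. exp (- \<alpha> * real i))) / m \<le>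
            1 + - (\<eta> * \<alpha> / 4)"
          using m by (simp add: field_simps)
        also have "\<dots> \<le> exp (- (\<eta> * \<alpha> / 4))" by (rule exp_ge_add_one_self)
        finally show "(\<Sum>d\<in>#A. exp (\<theta> * (real d - 1)) * (\<Sum>i<d. exp (- \<alpha> * real i))) / m \<le>
            exp (- (\<eta> * \<alpha> / 4))" .
      qed (simp add: E_def)
      also have "\<dots> = exp (K - \<eta> * \<alpha> / 4 * real h)"
        unfolding E_def by (simp flip: exp_add add: Suc algebra_simps add_divide_distrib)
      also have "\<dots> \<le> exp (2 * \<alpha> * real (Suc t) / n * c + 2 * B * \<alpha>\<^sup>2 * real (Suc t)
          - \<eta> * \<alpha> / 4 * real h)"
        unfolding K_def \<theta>_def using \<alpha> n c B
        by (intro exp_le_cancel_iff[THEN iffD2] diff_right_mono add_mono mult_right_mono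
            mult_left_mono divide_right_mono) auto
      finally show ?thesis by (simp add: \<open>M = 0\<close> c_def)
    qed
  qed
qed

section \<open>Long ancestral lines in short windows\<close>

lemma spine_le_length: "spine w \<le> length w"
  by (induction w) auto

lemma take_rotate_eq:
  "m + k \<le> length w \<Longrightarrow> take k (rotate m w) = take k (drop m w)"
  by (cases "m = length w") (auto simp: rotate_drop_take)

text \<open>A long line yields a suffix of the window that descends exactly h generations: its end
  is fixed and its start varies. Rotating to the start and reversing the sum over lengths gives
  prefixes with varying end, which \<open>visits\<close> counts.\<close>

lemma perm_avg_spine_le_visits:
  assumes "t \<le> size A"
  shows "perm_avg A (\<lambda>w. of_bool (h \<le> spine (take t w))) \<le> perm_avg A (visits 0 h t)"
proof -
  have "perm_avg A (\<lambda>w. of_bool (h \<le> spine (take t w))) \<le>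
      perm_avg A (\<lambda>w. \<Sum>k\<le>t. of_bool (reads 0 h (take (t - k) (rotate k w))))"
  proof (rule perm_avg_mono)
    fix w assume "mset w = A"
    then have len: "t \<le> length w" using assms by auto
    show "of_bool (h \<le> spine (take t w)) \<le>
        (\<Sum>k\<le>t. of_bool (reads 0 h (take (t - k) (rotate k w))) :: real)"
    proof (cases "h \<le> spine (take t w)")
      case True
      from spine_imp_reads_suffix[OF this] len
      obtain k where k: "k \<le> t" "reads 0 h (drop k (take t w))" by auto
      then have "reads 0 h (take (t - k) (rotate k w))"
        using len by (simp add: take_rotate_eq drop_take)
      then have "(1 :: real) = of_bool (reads 0 h (take (t - k) (rotate k w)))" by simp
      also have "\<dots> \<le> (\<Sum>k\<le>t. of_bool (reads 0 h (take (t - k) (rotate k w))))"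
        by (rule member_le_sum) (use k in auto)
      finally show ?thesis using True by simp
    qed (auto intro: sum_nonneg)
  qed
  also have "\<dots> = (\<Sum>k\<le>t. perm_avg A (\<lambda>w. of_bool (reads 0 h (take (t - k) w))))"
    unfolding perm_avg_sum by (rule sum.cong[OF refl], rule perm_avg_rotate)
  also have "\<dots> = (\<Sum>k\<le>t. perm_avg A (\<lambda>w. of_bool (reads 0 h (take k w))))"
    using sum.nat_diff_reindex[of "\<lambda>k. perm_avg A (\<lambda>w. of_bool (reads 0 h (take k w)))" "Suc t"]
    by (simp add: lessThan_Suc_atMost)
  also have "\<dots> = perm_avg A (\<lambda>w. \<Sum>k\<le>t. of_bool (reads 0 h (take k w)))"
    by (rule perm_avg_sum[symmetric])
  also have "\<dots> \<le> perm_avg A (visits 0 h t)"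
  proof (rule perm_avg_mono)
    fix w assume "mset w = A"
    then have len: "t \<le> length w" using assms by auto
    have "(\<Sum>k\<le>t. of_bool (reads 0 h (take k w)) :: real) =
        real (card {k. k \<le> t \<and> reads 0 h (take k w)})"
      by (simp add: of_bool_def sum.If_cases Collect_conj_eq atMost_def)
    also have "\<dots> \<le> visits 0 h t w" by (rule card_reads_le_visits[OF len])
    finally show "(\<Sum>k\<le>t. of_bool (reads 0 h (take k w))) \<le> visits 0 h t w" .
  qed
  finally show ?thesis .
qed

text \<open>With U the exponent of the conclusion, the choice of \<open>\<alpha>\<close> makes the
  height contribute -4U and the quadratic term 2U, while the hypothesis on the charge keeps the
  drift below U; what is left is -U.\<close>

lemma perm_avg_spine_tail:
  fixes A :: "nat multiset" and B \<eta> :: real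
  defines "n \<equiv> real (size A)"
  assumes t: "0 < t" and h: "(real h)\<^sup>2 \<le> n"
    and B: "1 \<le> B" and \<eta>: "0 < \<eta>" "\<eta> \<le> 1"
    and tn: "16 * B * real t \<le> \<eta> * n"
    and S: "(\<Sum>d\<in>#A. (real d)\<^sup>2 + 1) \<le> B * n"
    and two: "2 * \<eta> * n \<le> real (size (filter_mset (\<lambda>d. 2 \<le> d) A))"
    and c: "0 \<le> mset_charge A" "32 * real t * mset_charge A \<le> \<eta> * n * real h"
  shows "perm_avg A (\<lambda>w. of_bool (h \<le> spine (take t w))) \<le>
    exp (- (\<eta>\<^sup>2 / (256 * B) * (real h)\<^sup>2 / real t))"
proof (cases "h \<le> t")
  case False
  have "of_bool (h \<le> spine (take t w)) = (0::real)" for w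
    using False spine_le_length[of "take t w"] by simp
  then show ?thesis by simp
next
  case True
  \<comment> \<open>up to constants, the optimal exponent\<close>
  define \<alpha> where "\<alpha> = \<eta> * real h / (16 * B * real t)"
  have "1 * real t \<le> B * real t" using B by (intro mult_right_mono) auto
  then have tn': "16 * real t \<le> \<eta> * n" using tn by simp
  have "0 < n" using tn' t \<eta> by (smt (verit) of_nat_0_less_iff zero_less_mult_pos)
  have \<eta>n: "\<eta> * n \<le> n" using \<eta> \<open>0 < n\<close> by simp
  have tA: "t \<le> size A" using tn' \<eta>n unfolding n_def by linarith
  have "\<eta> * real h \<le> 1 * real t" using True \<eta> by (intro mult_mono) auto
  also have "\<dots> \<le> 16 * B * real t" using B by (intro mult_right_mono) auto
  finally have \<alpha>: "0 \<le> \<alpha>" "\<alpha> \<le> 1" using \<eta> B t by (auto simp: \<alpha>_def divide_le_eq)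
  have "perm_avg A (visits 0 h t) \<le>
    exp (- \<alpha> * real 0 + 2 * \<alpha> * real t / n * mset_charge A + 2 * B * \<alpha>\<^sup>2 * real t
      - \<eta> * \<alpha> / 4 * real h)"
  proof (rule perm_avg_visits_le[OF \<alpha> \<open>0 < n\<close>])
    show "n / 2 + real t \<le> real (size A)" "real (size A) \<le> n"
      using tn' \<eta>n by (auto simp: n_def)
    show "\<eta> * n + real t \<le> real (size (filter_mset (\<lambda>d. 2 \<le> d) A))"
      using two tn' by simp
    fix d assume d: "d \<in># A"
    obtain A' where A': "A = add_mset d A'" using d by (metis multi_member_split)
    \<comment> \<open>The square of a single letter is at most the whole sum, so d is at most sqrt
      (B * n). Together with \<open>h^2 \<le> n\<close> this controls the product h * d, to which
      the constraint on \<open>2 * \<alpha> * t * d\<close> reduces.\<close>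
    have "(\<Sum>d\<in>#A'. 0) \<le> (\<Sum>d\<in>#A'. (real d)\<^sup>2 + 1)" by (intro sum_mset_mono) simp
    then have "(real d)\<^sup>2 \<le> B * n" using S by (simp add: A')
    then have "(real h * real d)\<^sup>2 \<le> n * (B * n)"
      unfolding power_mult_distrib using h \<open>0 < n\<close> by (intro mult_mono) auto
    also have "\<dots> \<le> B * (n * (B * n))"
      using B \<open>0 < n\<close> mult_right_mono[of 1 B "n * (B * n)"] by simp
    also have "\<dots> = (B * n)\<^sup>2" by (simp add: power2_eq_square)
    finally have "real h * real d \<le> B * n" using B \<open>0 < n\<close> by (auto elim: power2_le_imp_le)
    then have "\<eta> * (real h * real d) \<le> 1 * (B * n)"
      using \<eta> by (intro mult_mono[of \<eta> 1 "real h * real d" "B * n"]) auto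
    also have "\<dots> \<le> 8 * B * n" using B \<open>0 < n\<close> by simp
    finally show "2 * \<alpha> * real t * real d \<le> n"
      using t B by (simp add: \<alpha>_def divide_le_eq mult.assoc mult.left_commute)
  qed (use S tn c \<eta> in auto)
  also have "\<dots> \<le> exp (- (\<eta>\<^sup>2 / (256 * B) * (real h)\<^sup>2 / real t))"
  proof -
    define U where "U = \<eta>\<^sup>2 / (256 * B) * (real h)\<^sup>2 / real t"
    have "2 * \<alpha> * real t / n * mset_charge A = \<alpha> / (16 * n) * (32 * real t * mset_charge A)"
      using \<open>0 < n\<close> by simp
    also have "\<dots> \<le> \<alpha> / (16 * n) * (\<eta> * n * real h)"
      using \<alpha> \<open>0 < n\<close> c by (intro mult_left_mono) auto
    also have "\<dots> = U"
      using \<open>0 < n\<close> B t by (simp add: U_def \<alpha>_def power2_eq_square mult_ac)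
    finally have 1: "2 * \<alpha> * real t / n * mset_charge A \<le> U" .
    have 2: "2 * B * \<alpha>\<^sup>2 * real t = 2 * U"
      using B t by (simp add: U_def \<alpha>_def power2_eq_square mult_ac)
    have 3: "\<eta> * \<alpha> / 4 * real h = 4 * U"
      using B t by (simp add: U_def \<alpha>_def power2_eq_square mult_ac)
    show ?thesis unfolding 2 3 U_def[symmetric] using 1 by simp
  qed
  finally show ?thesis using perm_avg_spine_le_visits[OF tA, of h] by linarith
qed

text \<open>Subadditivity of \<open>spine\<close> along the binary expansion of \<open>k\<close>.\<close>

lemma spine_chaining:
  fixes g :: "nat \<Rightarrow> real"
  assumes "\<And>r. 0 \<le> g r"
    and "\<And>r i. r < R \<Longrightarrow> i < 2 ^ (R - r) \<Longrightarrow> real (spine (take (2 ^ r) (drop (i * 2 ^ r) w))) \<le> g r"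
    and "k < 2 ^ R"
  shows "real (spine (take k w)) \<le> (\<Sum>r<R. g r)"
  using assms(2-)
proof (induction R arbitrary: w k)
  case (Suc R)
  show ?case
  proof (cases "k < 2 ^ R")
    case True
    have "real (spine (take k w)) \<le> (\<Sum>r<R. g r)"
    proof (rule Suc.IH[OF _ True])
      fix r i :: nat assume "r < R" "i < 2 ^ (R - r)"
      moreover from this have "i < 2 ^ (Suc R - r)"
        by (simp add: Suc_diff_le)
      ultimately show "real (spine (take (2 ^ r) (drop (i * 2 ^ r) w))) \<le> g r"
        by (intro Suc.prems) auto
    qed
    then show ?thesis using assms(1)[of R] by simp
  next
    case False
    define k' where "k' = k - 2 ^ R"
    have k: "k = 2 ^ R + k'" "k' < 2 ^ R" using False Suc.prems(2) by (auto simp: k'_def)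
    have "real (spine (take k' (drop (2 ^ R) w))) \<le> (\<Sum>r<R. g r)"
    proof (rule Suc.IH[OF _ k(2)])
      fix r i :: nat assume r: "r < R" "i < 2 ^ (R - r)"
      have "i + 2 ^ (R - r) < 2 ^ (Suc R - r)" using r by (simp add: Suc_diff_le)
      moreover have "i * 2 ^ r + 2 ^ R = (i + 2 ^ (R - r)) * 2 ^ r"
        using r by (simp add: algebra_simps flip: power_add)
      ultimately show "real (spine (take (2 ^ r) (drop (i * 2 ^ r) (drop (2 ^ R) w)))) \<le> g r"
        using Suc.prems(1)[of r "i + 2 ^ (R - r)"] r by simp
    qed
    moreover have "real (spine (take (2 ^ R) w)) \<le> g R"
      using Suc.prems(1)[of R 0] by simp
    moreover have "spine (take k w) \<le> spine (take (2 ^ R) w) + spine (take k' (drop (2 ^ R) w))"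
      unfolding k(1) take_add by (rule spine_append_le)
    ultimately show ?thesis by simp
  qed
qed simp

text \<open>If every dyadic block of level r stayed below \<open>g r\<close>, subadditivity would
  keep all prefixes below x. The union bound runs over the \<open>2 ^ (R - r)\<close> blocks of each
  level, and a rotation moves each of them to the front.\<close>

lemma perm_avg_spine_chaining:
  fixes g :: "nat \<Rightarrow> real"
  assumes g: "\<And>r. 0 \<le> g r" "(\<Sum>r<R. g r) \<le> x" and R: "2 ^ R \<le> size A"
  shows "perm_avg A (\<lambda>w. of_bool (\<exists>k<2 ^ R. x < real (spine (take k w)))) \<le>
    (\<Sum>r<R. 2 ^ (R - r) * perm_avg A (\<lambda>w. of_bool (g r < real (spine (take (2 ^ r) w)))))"
proof -
  have "perm_avg A (\<lambda>w. of_bool (\<exists>k<2 ^ R. x < real (spine (take k w)))) \<le>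
    perm_avg A (\<lambda>w. \<Sum>r<R. \<Sum>i<2 ^ (R - r).
      of_bool (g r < real (spine (take (2 ^ r) (rotate (i * 2 ^ r) w)))))"
  proof (rule perm_avg_mono)
    fix w assume w: "mset w = A"
    show "of_bool (\<exists>k<2 ^ R. x < real (spine (take k w))) \<le> (\<Sum>r<R. \<Sum>i<2 ^ (R - r).
      of_bool (g r < real (spine (take (2 ^ r) (rotate (i * 2 ^ r) w)))) :: real)"
    proof (cases "\<exists>k<2 ^ R. x < real (spine (take k w))")
      case True
      then obtain k where "k < 2 ^ R" "\<not> real (spine (take k w)) \<le> (\<Sum>r<R. g r)"
        using g(2) by force
      then obtain r i where ri: "r < R" "i < 2 ^ (R - r)"
        "g r < real (spine (take (2 ^ r) (drop (i * 2 ^ r) w)))"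
        using spine_chaining[OF g(1), where R = R and w = w and k = k] by (meson not_less)
      have "(i + 1) * 2 ^ r \<le> 2 ^ (R - r) * 2 ^ r" using ri by (intro mult_right_mono) auto
      also have "\<dots> \<le> length w" using ri R w by (auto simp flip: power_add)
      finally have "take (2 ^ r) (rotate (i * 2 ^ r) w) = take (2 ^ r) (drop (i * 2 ^ r) w)"
        by (intro take_rotate_eq) simp
      then have "(1::real) = of_bool (g r < real (spine (take (2 ^ r) (rotate (i * 2 ^ r) w))))"
        using ri by simp
      also have "\<dots> \<le> (\<Sum>i<2 ^ (R - r).
          of_bool (g r < real (spine (take (2 ^ r) (rotate (i * 2 ^ r) w)))))"
        by (rule member_le_sum) (use ri in auto)
      also have "\<dots> \<le> (\<Sum>r<R. \<Sum>i<2 ^ (R - r).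
          of_bool (g r < real (spine (take (2 ^ r) (rotate (i * 2 ^ r) w)))))"
        by (rule member_le_sum[where i = r]) (use ri in \<open>auto intro: sum_nonneg\<close>)
      finally show ?thesis using True by simp
    qed (auto intro!: sum_nonneg)
  qed
  also have "\<dots> = (\<Sum>r<R. \<Sum>i<(2::nat) ^ (R - r).
      perm_avg A (\<lambda>w. of_bool (g r < real (spine (take (2 ^ r) w)))))"
    unfolding perm_avg_sum
    by (intro sum.cong refl perm_avg_rotate)
  finally show ?thesis by simp
qed

text \<open>The rotation m is arbitrary, so windows may wrap around the end of the word. This
  enlarges the event, and makes it depend on the cyclic word only.\<close>

definition has_long_line :: "nat \<Rightarrow> real \<Rightarrow> nat list \<Rightarrow> bool" where
  "has_long_line L x w \<longleftrightarrow> (\<exists>m. \<exists>k\<le>L. x < real (spine (take k (rotate m w))))"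

text \<open>Starting points are rounded down to multiples of L. A window of length at most L then
  ends less than 2 * L after the grid point, and prepending letters never lowers
  \<open>spine\<close>.\<close>

lemma perm_avg_has_long_line:
  assumes L: "0 < L" "2 * L \<le> size A"
  shows "perm_avg A (\<lambda>w. of_bool (has_long_line L x w)) \<le>
    (real (size A div L) + 1) * perm_avg A (\<lambda>w. of_bool (\<exists>k<2 * L. x < real (spine (take k w))))"
proof -
  let ?n = "size A"
  have "perm_avg A (\<lambda>w. of_bool (has_long_line L x w)) \<le>
    perm_avg A (\<lambda>w. \<Sum>q\<le>?n div L. of_bool (\<exists>k<2 * L. x < real (spine (take k (rotate (q * L) w)))))"
  proof (rule perm_avg_mono)
    fix w assume w: "mset w = A"
    then have len: "length w = ?n" by auto
    show "of_bool (has_long_line L x w) \<le>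
      (\<Sum>q\<le>?n div L. of_bool (\<exists>k<2 * L. x < real (spine (take k (rotate (q * L) w)))) :: real)"
    proof (cases "has_long_line L x w")
      case True
      then obtain m0 k where k: "k \<le> L" "x < real (spine (take k (rotate m0 w)))"
        by (auto simp: has_long_line_def)
      define m where "m = m0 mod ?n"
      have rot: "rotate m w = rotate m0 w" using rotate_conv_mod[of m0 w] by (simp add: m_def len)
      have m: "m < ?n" using L by (simp add: m_def)
      define q where "q = m div L"
      define m' where "m' = m mod L"
      have q: "q \<le> ?n div L" using m by (simp add: q_def div_le_mono)
      have m': "m' < L" using L by (simp add: m'_def)
      let ?v = "rotate (q * L) w"
      have "rotate m w = rotate m' ?v" by (simp add: rotate_rotate q_def m'_def add.commute)
      then have "take k (rotate m w) = take k (drop m' ?v)"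
        using m' k L len by (simp add: take_rotate_eq)
      also have "\<dots> = drop m' (take (m' + k) ?v)" by (simp add: drop_take)
      finally have "spine (take k (rotate m w)) \<le> spine (take (m' + k) ?v)"
        by (metis spine_drop_le)
      then have "x < real (spine (take (m' + k) ?v))" using k rot by simp
      moreover have "m' + k < 2 * L" using m' k by simp
      ultimately have "(1::real) = of_bool (\<exists>k<2 * L. x < real (spine (take k ?v)))" by auto
      also have "\<dots> \<le> (\<Sum>q\<le>?n div L. of_bool (\<exists>k<2 * L. x < real (spine (take k (rotate (q * L) w)))))"
        by (rule member_le_sum) (use q in auto)
      finally show ?thesis by simp
    qed (auto intro: sum_nonneg)
  qed
  also have "\<dots> = (\<Sum>q\<le>?n div L. perm_avg A (\<lambda>w. of_bool (\<exists>k<2 * L. x < real (spine (take k w)))))"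
    unfolding perm_avg_sum by (rule sum.cong[OF refl], rule perm_avg_rotate)
  finally show ?thesis by (simp add: algebra_simps)
qed


lemma sum_power_diff_le:
  fixes q :: real
  assumes "0 < q" "q < 1"
  shows "(\<Sum>r<R. q ^ (R - r)) \<le> q / (1 - q)"
proof -
  have "(\<Sum>r<R. q ^ (R - r)) = (\<Sum>r<R. q ^ Suc (R - Suc r))"
    by (intro sum.cong refl arg_cong[of _ _ "(^) q"]) auto
  also have "\<dots> = (\<Sum>r<R. q ^ Suc r)"
    by (rule sum.nat_diff_reindex)
  also have "\<dots> = q * (\<Sum>r<R. q ^ r)" by (simp add: sum_distrib_left)
  also have "\<dots> = q * ((1 - q ^ R) / (1 - q))" using assms by (simp add: sum_gp_strict)
  also have "\<dots> \<le> q * (1 / (1 - q))"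
    using assms by (intro mult_left_mono divide_right_mono) auto
  finally show ?thesis by simp
qed

lemma exp_minus_le_inverse_square:
  fixes y :: real
  assumes "0 < y"
  shows "exp (- y) \<le> 2 / y\<^sup>2"
proof -
  have "y\<^sup>2 / 2 \<le> exp y" using exp_lower_Taylor_quadratic[of y] assms by simp
  then show ?thesis using assms by (simp add: exp_minus field_simps)
qed

text \<open>The lower bounds on J let blocks of length up to 2 * L meet the constraints of
  \<open>perm_avg_spine_tail\<close>. Since \<open>L \<le> 2 * n / J\<close>, the constant 64 is 16
  * 2 * 2, and 1152 is 64 * 9 * 2 with the 9 coming from the thresholds \<open>g\<close>.\<close>

lemma perm_avg_has_long_line_le:
  fixes A :: "nat multiset" and b B C \<eta> :: real and J R :: nat
  defines "n \<equiv> real (size A)" and "\<gamma> \<equiv> \<eta>\<^sup>2 / (256 * B)"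
  assumes J: "0 < J" "n \<le> real J * 2 ^ R" "real J * 2 ^ R \<le> 2 * n"
    and b: "0 < b" "b \<le> 1 / 2" and n: "4 \<le> n"
    and B: "1 \<le> B" and \<eta>: "0 < \<eta>" "\<eta> \<le> 1"
    and S: "(\<Sum>d\<in>#A. (real d)\<^sup>2 + 1) \<le> B * n"
    and two: "2 * \<eta> * n \<le> real (size (filter_mset (\<lambda>d. 2 \<le> d) A))"
    and c: "0 \<le> mset_charge A" "mset_charge A \<le> C * sqrt n"
    and J': "64 * B \<le> \<eta> * real J" "1152 * C \<le> \<eta> * b * real J"
  shows "perm_avg A (\<lambda>w. of_bool (has_long_line (2 ^ R) (b * sqrt n) w)) \<le>
    16 * (324 / (\<gamma> * b\<^sup>2))\<^sup>2 / real J"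
proof -
  define L :: real where "L = 2 ^ R"
  define x where "x = b * sqrt n"
  define Y where "Y = \<gamma> * x\<^sup>2 / (162 * L)"
  \<comment> \<open>Put q = 9/10 and let s be the number of levels below the top. The prefactor 1/9
    = (1 - q) / q makes the thresholds sum to at most x. The exponent at level s is at least
    \<open>Y * (2 * q^2) ^ s\<close>, and the inverse square of this outweighs the
    \<open>2 ^ s\<close> blocks because 2 * q^4 > 1.\<close>
  define g where "g r = x / 9 * (9 / 10) ^ (Suc R - r)" for r
  have pos: "0 < n" "0 < L" "0 < x" "0 < \<gamma>" "0 < Y" "0 < real J"
    using n b B \<eta> J(1) by (auto simp: L_def x_def \<gamma>_def Y_def)
  have C: "0 \<le> C" using c pos(1) by (smt (verit) mult_neg_pos real_sqrt_gt_zero)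
  have x2: "x\<^sup>2 = b\<^sup>2 * n" using pos by (simp add: x_def power_mult_distrib)
  have LJ: "real J * L \<le> 2 * n" "n \<le> real J * L" using J by (auto simp: L_def)
  have BL: "16 * B * (2 * L) \<le> \<eta> * n"
  proof -
    have "real J * (16 * B * (2 * L)) = 32 * B * (real J * L)" by simp
    also have "\<dots> \<le> 32 * B * (2 * n)" using LJ B by (intro mult_left_mono) auto
    also have "\<dots> = (64 * B) * n" by simp
    also have "\<dots> \<le> \<eta> * real J * n" using J' pos by (intro mult_right_mono) auto
    finally have "real J * (16 * B * (2 * L)) \<le> real J * (\<eta> * n)" by (simp add: mult_ac)
    then show ?thesis using pos by simp
  qed
  have CL: "576 * L * C \<le> \<eta> * b * n"
  proof -
    have "real J * (576 * L * C) = 576 * C * (real J * L)" by simp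
    also have "\<dots> \<le> 576 * C * (2 * n)" using LJ C by (intro mult_left_mono) auto
    also have "\<dots> = (1152 * C) * n" by simp
    also have "\<dots> \<le> \<eta> * b * real J * n" using J' pos by (intro mult_right_mono) auto
    finally have "real J * (576 * L * C) \<le> real J * (\<eta> * b * n)" by (simp add: mult_ac)
    then show ?thesis using pos by simp
  qed
  have "1 * (32 * L) \<le> B * (32 * L)" using B pos by (intro mult_right_mono) auto
  moreover have "\<eta> * n \<le> n" using \<eta> pos by simp
  ultimately have Ln: "32 * L \<le> n" using BL by simp
  \<comment> \<open>Thresholds get rounded up to integers h below; this leaves the room to keep
    \<open>h^2 \<le> n\<close>.\<close>
  have x_le: "x + 1 \<le> sqrt n"
  proof -
    have "2 \<le> sqrt n" using n real_sqrt_le_mono[of 4 n] by simp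
    moreover have "x \<le> 1 / 2 * sqrt n" unfolding x_def using b pos by (intro mult_right_mono) auto
    ultimately show ?thesis by simp
  qed
  have level: "perm_avg A (\<lambda>w. of_bool (g r < real (spine (take (2 ^ r) w)))) \<le>
      2 / Y\<^sup>2 * (2500 / 6561) ^ (Suc R - r)" if r: "r < Suc R" for r
  proof -
    define s where "s = Suc R - r"
    define t :: nat where "t = 2 ^ r"
    define h where "h = Suc (nat \<lfloor>g r\<rfloor>)"
    have t: "real t * 2 ^ s = 2 * L" "0 < t"
      using r by (auto simp: t_def s_def L_def simp flip: power_add)
    have "real t * 1 \<le> real t * 2 ^ s" by (intro mult_left_mono) auto
    then have tL: "real t \<le> 2 * L" using t by simp
    have g: "0 < g r" "g r \<le> x"
    proof -
      have "x / 9 * (9 / 10) ^ (Suc R - r) \<le> x * 1"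
        using pos by (intro mult_mono power_le_one) auto
      then show "g r \<le> x" by (simp add: g_def)
    qed (use pos in \<open>simp add: g_def\<close>)
    have h: "g r \<le> real h" "real h \<le> g r + 1" using g(1) unfolding h_def by linarith+
    have "real h \<le> sqrt n" using h g x_le by linarith
    then have h2: "(real h)\<^sup>2 \<le> n" using pos
      by (metis of_nat_0_le_iff power_mono real_sqrt_pow2 less_imp_le)
    have ge: "h \<le> spine v" if "g r < real (spine v)" for v
      using that g(1) unfolding h_def by linarith
    have "perm_avg A (\<lambda>w. of_bool (g r < real (spine (take t w)))) \<le>
        perm_avg A (\<lambda>w. of_bool (h \<le> spine (take t w)))"
      using ge by (intro perm_avg_mono) (auto simp: of_bool_def)
    also have "\<dots> \<le> exp (- (\<eta>\<^sup>2 / (256 * B) * (real h)\<^sup>2 / real t))"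
    proof (rule perm_avg_spine_tail)
      show "16 * B * real t \<le> \<eta> * real (size A)"
        using mult_left_mono[OF tL, of "16 * B"] B BL unfolding n_def by linarith
      have "32 * real t * mset_charge A \<le> 32 * real t * (C * sqrt n)"
        using c by (intro mult_left_mono) auto
      also have "\<dots> = 64 * L * C * sqrt n * (1 / 2) ^ s"
        using t(1) by (simp add: power_divide field_simps)
      \<comment> \<open>From one level to the next the drift halves while the threshold only shrinks
        by 9/10, so the drift condition is tightest at the top level.\<close>
      also have "\<dots> \<le> 64 * L * C * sqrt n * (9 / 10) ^ s"
        using pos C by (intro mult_left_mono power_mono) auto
      also have "\<dots> = (576 * L * C) * (sqrt n / 9 * (9 / 10) ^ s)" by simp
      also have "\<dots> \<le> (\<eta> * b * n) * (sqrt n / 9 * (9 / 10) ^ s)"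
        using CL pos by (intro mult_right_mono) auto
      also have "\<dots> = \<eta> * n * g r" by (simp add: g_def x_def s_def)
      also have "\<dots> \<le> \<eta> * n * real h" using h \<eta> pos by (intro mult_left_mono) auto
      finally show "32 * real t * mset_charge A \<le> \<eta> * real (size A) * real h"
        by (simp add: n_def)
    qed (use t h2 B \<eta> S two c in \<open>auto simp: n_def\<close>)
    also have "\<dots> \<le> exp (- (Y * (81 / 50) ^ s))"
    proof -
      have "Y * (81 / 50) ^ s = \<gamma> * (x / 9 * (9 / 10) ^ s)\<^sup>2 * 2 ^ s / (2 * L)"
      proof -
        have "((9 / 10 :: real) ^ s)\<^sup>2 * 2 ^ s = (81 / 50) ^ s"
          by (simp add: power2_eq_square flip: power_mult_distrib)
        then show ?thesis
          unfolding Y_def power_mult_distrib power_divide[of x] by (simp add: mult.assoc)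
      qed
      also have "\<dots> = \<gamma> * (g r)\<^sup>2 / real t"
        unfolding t(1)[symmetric] g_def s_def[symmetric] using t(2) by simp
      also have "\<dots> \<le> \<gamma> * (real h)\<^sup>2 / real t"
        using h g pos t by (intro divide_right_mono mult_left_mono power_mono) auto
      finally show ?thesis by (simp add: \<gamma>_def)
    qed
    also have "\<dots> \<le> 2 / (Y * (81 / 50) ^ s)\<^sup>2"
      using pos by (intro exp_minus_le_inverse_square) simp
    also have "\<dots> = 2 / Y\<^sup>2 * (2500 / 6561) ^ s"
      by (simp add: power2_eq_square power_divide flip: power_mult_distrib)
    finally show ?thesis by (simp add: t_def s_def)
  qed
  have "perm_avg A (\<lambda>w. of_bool (\<exists>k<2 ^ Suc R. x < real (spine (take k w)))) \<le>
    (\<Sum>r<Suc R. 2 ^ (Suc R - r) * perm_avg A (\<lambda>w. of_bool (g r < real (spine (take (2 ^ r) w)))))"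
  proof (rule perm_avg_spine_chaining)
    have "(\<Sum>r<Suc R. g r) = x / 9 * (\<Sum>r<Suc R. (9 / 10) ^ (Suc R - r))"
      by (simp only: g_def sum_distrib_left)
    also have "\<dots> \<le> x / 9 * ((9 / 10) / (1 - 9 / 10))"
      using pos by (intro mult_left_mono sum_power_diff_le) auto
    finally show "(\<Sum>r<Suc R. g r) \<le> x" by simp
    have "real (2 ^ Suc R) \<le> n" using Ln pos by (simp add: L_def)
    then show "2 ^ Suc R \<le> size A" unfolding n_def by linarith
  qed (use pos in \<open>simp add: g_def\<close>)
  also have "\<dots> \<le> (\<Sum>r<Suc R. 2 ^ (Suc R - r) * (2 / Y\<^sup>2 * (2500 / 6561) ^ (Suc R - r)))"
    using level by (intro sum_mono mult_left_mono) auto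
  also have "\<dots> = 2 / Y\<^sup>2 * (\<Sum>r<Suc R. (5000 / 6561) ^ (Suc R - r))"
    unfolding sum_distrib_left
    by (intro sum.cong refl) (simp add: power_divide flip: power_mult_distrib)
  also have "\<dots> \<le> 2 / Y\<^sup>2 * ((5000 / 6561) / (1 - 5000 / 6561))"
    by (intro mult_left_mono sum_power_diff_le) auto
  also have "\<dots> \<le> 8 / Y\<^sup>2" using pos by (simp add: field_simps)
  finally have window: "perm_avg A (\<lambda>w. of_bool (\<exists>k<2 * 2 ^ R. x < real (spine (take k w)))) \<le> 8 / Y\<^sup>2"
    by simp
  have "perm_avg A (\<lambda>w. of_bool (has_long_line (2 ^ R) x w)) \<le> (real (size A div 2 ^ R) + 1) *
      perm_avg A (\<lambda>w. of_bool (\<exists>k<2 * 2 ^ R. x < real (spine (take k w))))"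
  proof (rule perm_avg_has_long_line)
    have "real (2 * 2 ^ R) \<le> n" using Ln pos by (simp add: L_def)
    then show "2 * 2 ^ R \<le> size A" unfolding n_def by linarith
  qed simp
  also have "\<dots> \<le> (2 * real J) * (8 / Y\<^sup>2)"
  proof (intro mult_mono window)
    have "real (size A div 2 ^ R * 2 ^ R) \<le> n"
      unfolding n_def of_nat_le_iff by (rule div_times_less_eq_dividend)
    then have "real (size A div 2 ^ R) \<le> n / L"
      using pos by (simp add: L_def le_divide_eq)
    also have "\<dots> \<le> real J" using LJ pos by (simp add: divide_le_eq)
    finally show "real (size A div 2 ^ R) + 1 \<le> 2 * real J" using J(1) by simp
  qed (auto simp: perm_avg_def intro!: divide_nonneg_nonneg sum_nonneg)
  also have "\<dots> \<le> (2 * real J) * (8 / (\<gamma> * b\<^sup>2 / 324 * real J)\<^sup>2)"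
  proof -
    \<comment> \<open>\<open>Y\<close> is at least linear in J, because L is at most 2 * n / J; here
      324 is twice 162.\<close>
    have "\<gamma> * b\<^sup>2 / 324 * real J = \<gamma> * b\<^sup>2 * (real J * L) / (324 * L)" using pos by simp
    also have "\<dots> \<le> \<gamma> * b\<^sup>2 * (2 * n) / (324 * L)"
      using LJ pos by (intro divide_right_mono mult_left_mono) auto
    also have "\<dots> = Y" by (simp add: Y_def x2)
    finally show ?thesis using pos b
      by (intro mult_left_mono divide_left_mono power_mono mult_pos_pos zero_less_power) auto
  qed
  also have "\<dots> = 16 * (324 / (\<gamma> * b\<^sup>2))\<^sup>2 / real J"
    using pos b by (simp add: power2_eq_square field_simps)
  finally show ?thesis by (simp add: x_def)
qed

section \<open>The cycle lemma\<close>

lemma charge_drop: "charge (drop j w) = (\<Sum>i=j..<length w. 1 - int (w ! i))"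
proof (cases "j \<le> length w")
  case True
  have "charge (drop j w) = (\<Sum>i=0..<length w - j. 1 - int (w ! (j + i)))"
    unfolding charge_def by (simp add: sum_list_sum_nth)
  also have "\<dots> = (\<Sum>i=j..<length w. 1 - int (w ! i))"
    using True sum.shift_bounds_nat_ivl[of "\<lambda>i. 1 - int (w ! i)" 0 j "length w - j"]
    by (simp add: add.commute)
  finally show ?thesis .
qed simp

text \<open>Rotations that are forest words correspond to the strict record times of the periodically
  continued walk during one period; since the walk climbs by at most one per step, its running
  maximum gains exactly \<open>c\<close> records per period.\<close>

lemma card_forest_rotations:
  assumes "charge w = int c" "0 < c"
  shows "card {r. r < length w \<and> is_forest_word (rotate r w)} = c"
proof -
  define n where "n = length w"
  have "w \<noteq> []" using assms by auto
  then have n: "n > 0" by (simp add: n_def)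
  define f where "f i = 1 - int (w ! (i mod n))" for i
  define T where "T k = (\<Sum>i<k. f i)" for k
  have T_Suc: "T (Suc k) \<le> T k + 1" for k by (simp add: T_def f_def)
  have T_period: "T (k + n) = T k + int c" for k
  proof (induction k)
    case 0
    have "T n = charge (drop 0 w)"
      unfolding T_def charge_drop by (simp add: f_def n_def atLeast0LessThan)
    then show ?case using assms by (simp add: T_def)
  next
    case (Suc k)
    then show ?case by (simp add: T_def f_def)
  qed
  define rec where "rec k \<longleftrightarrow> (\<forall>i<k. T i < T k)" for k
  have charge_rot: "charge (drop j (rotate r w)) = T (r + n) - T (r + j)" if "j < n" "r < n" for j r
  proof -
    have "charge (drop j (rotate r w)) = (\<Sum>i=j..<n. f (r + i))"
      unfolding charge_drop
      by (intro sum.cong) (auto simp: n_def f_def nth_rotate add.commute)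
    also have "\<dots> = (\<Sum>i=r + j..<r + n. f i)"
      using sum.shift_bounds_nat_ivl[of f j r n] by (simp add: add.commute)
    also have "\<dots> = T (r + n) - T (r + j)"
      using sum_diff_nat_ivl[of 0 "r + j" "r + n" f] that by (simp add: T_def atLeast0LessThan)
    finally show ?thesis .
  qed
  have good: "is_forest_word (rotate r w) \<longleftrightarrow> rec (r + n)" if r: "r < n" for r
  proof -
    have "is_forest_word (rotate r w) \<longleftrightarrow> (\<forall>j<n. T (r + j) < T (r + n))"
      unfolding is_forest_word_iff using charge_rot[OF _ r] by (auto simp: n_def)
    also have "\<dots> \<longleftrightarrow> rec (r + n)"
    proof
      assume *: "\<forall>j<n. T (r + j) < T (r + n)"
      \<comment> \<open>A time before r lies one period before a time already covered, and there the
        walk is lower by c.\<close>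
      have "T i < T (r + n)" if "i < r + n" for i
      proof (cases "i < r")
        case True
        have "i + n < r + n" "r \<le> i + n" using True r by auto
        then have "r + (i + n - r) = i + n" "i + n - r < n" by auto
        then have "T (i + n) < T (r + n)" using * by metis
        then show ?thesis using T_period[of i] by simp
      next
        case False
        then show ?thesis using *[rule_format, of "i - r"] that by simp
      qed
      then show "rec (r + n)" by (simp add: rec_def)
    qed (simp add: rec_def)
    finally show ?thesis .
  qed
  define Mx where "Mx k = Max (T ` {..k})" for k
  have Mx_ge: "T i \<le> Mx k" if "i \<le> k" for i k using that by (simp add: Mx_def)
  have Mx_ex: "\<exists>i\<le>k. Mx k = T i" for k
    using Max_in[of "T ` {..k}"] unfolding Mx_def by fastforce
  have Mx_Suc: "Mx (Suc k) = Mx k + (if rec (Suc k) then 1 else 0)" for k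
  proof -
    have 1: "Mx (Suc k) = max (T (Suc k)) (Mx k)" by (simp add: Mx_def atMost_Suc)
    have 2: "rec (Suc k) \<longleftrightarrow> Mx k < T (Suc k)"
      using Mx_ge[of _ k] Mx_ex[of k] unfolding rec_def less_Suc_eq_le by force
    have "T (Suc k) \<le> Mx k + 1" using T_Suc[of k] Mx_ge[of k k] by simp
    then show ?thesis using 1 2 by auto
  qed
  have records: "Mx (k + m) = Mx k + int (card {j. k < j \<and> j \<le> k + m \<and> rec j})" for k m
  proof (induction m)
    case (Suc m)
    have "{j. k < j \<and> j \<le> k + Suc m \<and> rec j} =
        {j. k < j \<and> j \<le> k + m \<and> rec j} \<union> (if rec (Suc (k + m)) then {Suc (k + m)} else {})"
      by (auto simp: le_Suc_eq)
    moreover have "finite {j. k < j \<and> j \<le> k + m \<and> rec j}" by simp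
    ultimately show ?case using Suc Mx_Suc[of "k + m"] by auto
  qed auto
  have "Mx (n - 1 + n) = Mx (n - 1) + int c"
  proof (rule antisym)
    obtain i where i: "i \<le> n - 1 + n" "Mx (n - 1 + n) = T i" using Mx_ex by blast
    show "Mx (n - 1 + n) \<le> Mx (n - 1) + int c"
    proof (cases "i < n")
      case True
      then have "T i \<le> Mx (n - 1)" by (intro Mx_ge) simp
      then show ?thesis using i by simp
    next
      case False
      then have "T i = T (i - n) + int c" using T_period[of "i - n"] by simp
      moreover have "T (i - n) \<le> Mx (n - 1)" using i n by (intro Mx_ge) simp
      ultimately show ?thesis using i by simp
    qed
    obtain i where i: "i \<le> n - 1" "Mx (n - 1) = T i" using Mx_ex by blast
    have "T (i + n) \<le> Mx (n - 1 + n)" using i by (intro Mx_ge) simp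
    then show "Mx (n - 1) + int c \<le> Mx (n - 1 + n)" using i T_period[of i] by simp
  qed
  then have "card {j. n - 1 < j \<and> j \<le> n - 1 + n \<and> rec j} = c" using records by simp
  moreover have "{j. n - 1 < j \<and> j \<le> n - 1 + n \<and> rec j} = (\<lambda>r. r + n) ` {r. r < n \<and> rec (r + n)}"
  proof (intro equalityI subsetI)
    fix j assume "j \<in> {j. n - 1 < j \<and> j \<le> n - 1 + n \<and> rec j}"
    then show "j \<in> (\<lambda>r. r + n) ` {r. r < n \<and> rec (r + n)}"
      using n by (intro image_eqI[of _ _ "j - n"]) auto
  qed (use n in auto)
  ultimately have "card {r. r < n \<and> rec (r + n)} = c"
    by (simp add: card_image)
  moreover have "{r. r < length w \<and> is_forest_word (rotate r w)} = {r. r < n \<and> rec (r + n)}"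
    using good by (auto simp: n_def)
  ultimately show ?thesis by simp
qed

text \<open>Every word has exactly c forest words among its rotations, and P does not distinguish
  between them. Hence forest words have the same share inside P as among all arrangements.\<close>

lemma perm_avg_forest_word:
  assumes charge: "mset_charge A = real c" "0 < c" and P: "\<And>m w. P (rotate m w) = P w"
  shows "real (size A) * perm_avg A (\<lambda>w. of_bool (P w \<and> is_forest_word w)) =
    real c * perm_avg A (\<lambda>w. of_bool (P w))"
proof -
  have "real (size A) * perm_avg A (\<lambda>w. of_bool (P w \<and> is_forest_word w)) =
      (\<Sum>r<size A. perm_avg A (\<lambda>w. of_bool (P (rotate r w) \<and> is_forest_word (rotate r w))))"
    by (simp add: perm_avg_rotate[where f = "\<lambda>w. of_bool (P w \<and> is_forest_word w)"])
  also have "\<dots> = perm_avg A (\<lambda>w. \<Sum>r<size A. of_bool (P w \<and> is_forest_word (rotate r w)))"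
    unfolding P by (rule perm_avg_sum[symmetric])
  also have "\<dots> = perm_avg A (\<lambda>w. real c * of_bool (P w))"
  proof (rule perm_avg_cong)
    fix w assume w: "mset w = A"
    have "real_of_int (charge w) = mset_charge A"
      unfolding w[symmetric] by (induction w) (auto simp: mset_charge_def)
    then have "charge w = int c" using charge by linarith
    then have "real (card {r. r < size A \<and> is_forest_word (rotate r w)}) = real c"
      using card_forest_rotations[of w c] charge w by (metis size_mset)
    then show "(\<Sum>r<size A. of_bool (P w \<and> is_forest_word (rotate r w))) = real c * of_bool (P w)"
      by (simp add: of_bool_def sum.If_cases Collect_conj_eq lessThan_def)
  qed
  also have "\<dots> = real c * perm_avg A (\<lambda>w. of_bool (P w))"
    by (simp add: perm_avg_def sum_distrib_left)
  finally show ?thesis .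
qed

section \<open>Transfer from arrangements to the uniform forest\<close>

lemma card_forests_with_degrees:
  assumes "\<And>i. count A i = s i"
  shows "real (card ({F. has_degree_sequence F s} \<inter> {F. Q (forest_word F)})) =
    real (card (permutations_of_multiset A)) * perm_avg A (\<lambda>w. of_bool (Q w \<and> is_forest_word w))"
proof -
  let ?S = "{F. has_degree_sequence F s} \<inter> {F. Q (forest_word F)}"
  have S_iff: "has_degree_sequence F s \<longleftrightarrow> forest_word F \<in> permutations_of_multiset A" for F
    by (auto simp: has_degree_sequence_iff permutations_of_multiset_def multiset_eq_iff assms)
  have "forest_word ` ?S = permutations_of_multiset A \<inter> {w. Q w \<and> is_forest_word w}"
  proof (intro equalityI subsetI)
    fix w assume w: "w \<in> permutations_of_multiset A \<inter> {w. Q w \<and> is_forest_word w}"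
    then have "forest_word (parse w) = w" using parse_forest_word by auto
    then show "w \<in> forest_word ` ?S"
      using w by (intro image_eqI[of _ _ "parse w"]) (auto simp: S_iff)
  qed (auto simp: S_iff is_forest_word_forest_word)
  moreover have "inj_on forest_word ?S"
    using bij_betw_imp_inj_on[OF bij_betw_forest_word] by (rule inj_on_subset) simp
  ultimately have "card ?S = card (permutations_of_multiset A \<inter> {w. Q w \<and> is_forest_word w})"
    by (metis card_image)
  then show ?thesis by (simp add: perm_avg_def of_bool_def sum.If_cases)
qed

text \<open>The cycle lemma for the trivial event gives the share of forest words. Positive
  cardinality says at once that the set of forests is finite and nonempty, as
  \<open>pmf_of_set\<close> demands.\<close>

lemma card_forests_pos:
  assumes A: "\<And>i. count A i = s i" and charge: "mset_charge A = real c" "0 < c"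
  shows "card {F. has_degree_sequence F s} > 0" "size A > 0"
    "real (card {F. has_degree_sequence F s}) =
      real (card (permutations_of_multiset A)) * (real c / real (size A))"
proof -
  show size: "size A > 0"
    using charge by (cases "A = {#}") (auto simp: mset_charge_def nonempty_has_size)
  have "real (size A) * perm_avg A (\<lambda>w. of_bool (is_forest_word w)) = real c"
    using perm_avg_forest_word[OF charge, of "\<lambda>_. True"] by simp
  then have "perm_avg A (\<lambda>w. of_bool (is_forest_word w)) = real c / real (size A)"
    using size by (auto simp: eq_divide_eq mult.commute)
  then show card: "real (card {F. has_degree_sequence F s}) =
      real (card (permutations_of_multiset A)) * (real c / real (size A))"
    using card_forests_with_degrees[where A = A and s = s and Q = "\<lambda>_. True", OF A] by simp
  have "real (card {F. has_degree_sequence F s}) > 0"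
    unfolding card using charge size by (simp add: card_gt_0_iff)
  then show "card {F. has_degree_sequence F s} > 0" by simp
qed

lemma set_pmf_uniform_forest:
  assumes "\<And>i. count A i = s i" "mset_charge A = real c" "0 < c"
  shows "set_pmf (uniform_forest s) = {F. has_degree_sequence F s}"
  using card_forests_pos(1)[OF assms] unfolding uniform_forest_def card_gt_0_iff
  by (intro set_pmf_of_set) auto

lemma prob_uniform_forest:
  assumes A: "\<And>i. count A i = s i" and charge: "mset_charge A = real c" "0 < c"
    and P: "\<And>m w. P (rotate m w) = P w"
  shows "measure_pmf.prob (uniform_forest s) {F. P (forest_word F)} = perm_avg A (\<lambda>w. of_bool (P w))"
proof -
  define S where "S = {F. has_degree_sequence F s}"
  note pos = card_forests_pos[OF A charge, folded S_def]
  have "measure_pmf.prob (uniform_forest s) {F. P (forest_word F)} =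
      real (card (S \<inter> {F. P (forest_word F)})) / real (card S)"
    unfolding uniform_forest_def S_def[symmetric]
    using pos(1) by (simp add: measure_pmf_of_set card_gt_0_iff)
  also have "real (card (S \<inter> {F. P (forest_word F)})) =
      real (card (permutations_of_multiset A)) * perm_avg A (\<lambda>w. of_bool (P w \<and> is_forest_word w))"
    unfolding S_def by (rule card_forests_with_degrees[OF A])
  also have "perm_avg A (\<lambda>w. of_bool (P w \<and> is_forest_word w)) =
      real c * perm_avg A (\<lambda>w. of_bool (P w)) / real (size A)"
    using perm_avg_forest_word[OF charge P] pos(2) by (auto simp: eq_divide_eq mult.commute)
  also have "real (card (permutations_of_multiset A)) * \<dots> / real (card S) =
      perm_avg A (\<lambda>w. of_bool (P w))"
    unfolding pos(3) using pos(2) charge(2) by (auto simp: card_gt_0_iff)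
  finally show ?thesis .
qed

lemma has_long_line_rotate: "has_long_line L x (rotate m w) = has_long_line L x w"
proof
  assume "has_long_line L x (rotate m w)"
  then show "has_long_line L x w" unfolding has_long_line_def by (auto simp: rotate_rotate)
next
  assume "has_long_line L x w"
  then obtain m' k where k: "k \<le> L" "x < real (spine (take k (rotate m' w)))"
    by (auto simp: has_long_line_def)
  show "has_long_line L x (rotate m w)"
  proof (cases "w = []")
    case True
    then show ?thesis using k by (auto simp: has_long_line_def)
  next
    case False
    \<comment> \<open>Rotating by m is undone by rotating \<open>m * (length w - 1)\<close> further,
      since together these are m full turns.\<close>
    define q where "q = m' + m * (length w - 1)"
    have "q + m = m' + m * length w" using False by (cases w) (auto simp: q_def)
    then have "rotate (q + m) w = rotate m' w"
      by (metis mod_mult_self1 mult.commute rotate_conv_mod)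
    then have "rotate q (rotate m w) = rotate m' w" by (simp add: rotate_rotate)
    then show ?thesis using k unfolding has_long_line_def by metis
  qed
qed

section \<open>Diameters of low-ranked trees\<close>

lemma vertices_prefix: "v @ u \<in> vertices t \<Longrightarrow> v \<in> vertices t"
proof (induction v arbitrary: t)
  case (Cons i v)
  obtain ts where t: "t = PNode ts" by (cases t)
  show ?case using Cons unfolding t by (auto simp del: vertices.simps)
qed simp

lemma root_path: "v \<in> vertices t \<Longrightarrow> ([], v) \<in> tree_edges t ^^ length v"
proof (induction v rule: rev_induct)
  case (snoc i v)
  have v: "v \<in> vertices t" using snoc.prems by (rule vertices_prefix)
  then have "(v, v @ [i]) \<in> tree_edges t" using snoc.prems by (auto simp: tree_edges_def)
  then show ?case using snoc.IH[OF v] by auto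
qed simp

lemma path_to_root: "v \<in> vertices t \<Longrightarrow> (v, []) \<in> tree_edges t ^^ length v"
proof (induction v rule: rev_induct)
  case (snoc i v)
  have v: "v \<in> vertices t" using snoc.prems by (rule vertices_prefix)
  then have "(v @ [i], v) \<in> tree_edges t" using snoc.prems by (auto simp: tree_edges_def)
  from relpow_Suc_I2[OF this snoc.IH[OF v]] show ?case by simp
qed simp

lemma graph_dist_le:
  assumes "u \<in> vertices t" "v \<in> vertices t"
  shows "graph_dist t u v \<le> length u + length v"
proof -
  have "(u, v) \<in> tree_edges t ^^ (length u + length v)"
    using path_to_root[OF assms(1)] root_path[OF assms(2)] by (auto simp: relpow_add)
  then show ?thesis unfolding graph_dist_def by (rule Least_le)
qed

lemma mset_ranked_trees [simp]: "mset (ranked_trees F) = mset F"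
  by (simp add: ranked_trees_def)

lemma length_forest_word: "length (forest_word F) = (\<Sum>t\<leftarrow>F. card (vertices t))"
  by (induction F) (auto simp: card_vertices)

text \<open>Each of the l trees of rank at most l is at least as large as the one of rank l, and
  together they fit into the forest.\<close>

lemma ranked_tree_size:
  assumes "1 \<le> l" "l \<le> length F"
  shows "l * card (vertices (ranked_trees F ! (l - 1))) \<le> length (forest_word F)"
proof -
  define R where "R = ranked_trees F"
  have len: "length R = length F" unfolding R_def by (metis mset_ranked_trees size_mset)
  have sorted: "sorted (map (\<lambda>t. - int (card (vertices t))) R)"
    unfolding R_def ranked_trees_def by (rule sorted_sort_key)
  have "l * card (vertices (R ! (l - 1))) = (\<Sum>i<l. card (vertices (R ! (l - 1))))" by simp
  also have "\<dots> \<le> (\<Sum>i<l. card (vertices (R ! i)))"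
  proof (intro sum_mono)
    fix i assume "i \<in> {..<l}"
    then show "card (vertices (R ! (l - 1))) \<le> card (vertices (R ! i))"
      using sorted_nth_mono[OF sorted, of i "l - 1"] assms len by simp
  qed
  also have "\<dots> \<le> (\<Sum>i<length R. card (vertices (R ! i)))"
    using assms len by (intro sum_mono2) auto
  also have "\<dots> = (\<Sum>t\<leftarrow>R. card (vertices t))"
    by (simp add: sum_list_sum_nth atLeast0LessThan)
  also have "\<dots> = (\<Sum>t\<in>#mset R. card (vertices t))"
    by (simp flip: sum_mset_sum_list)
  also have "\<dots> = (\<Sum>t\<leftarrow>F. card (vertices t))"
    unfolding R_def by (simp flip: sum_mset_sum_list)
  also have "\<dots> = length (forest_word F)"
    by (rule length_forest_word[symmetric])
  finally show ?thesis by (simp add: R_def)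
qed

text \<open>Rotating the forest word to the first letter of t turns the letters preceding v in t
  into a window at the front.\<close>

lemma vertex_length_le:
  assumes "\<not> has_long_line L x (forest_word F)" "t \<in> set F" "card (vertices t) \<le> L"
    and v: "v \<in> vertices t"
  shows "real (length v) \<le> x"
proof -
  obtain p q where pq: "degree_word t = p @ q" "reads 0 (length v) p"
    using vertex_imp_reads[OF v] by blast
  obtain F1 F2 where F: "F = F1 @ t # F2" using assms(2) by (meson split_list)
  have "rotate (length (forest_word F1)) (forest_word F) = (p @ q @ forest_word F2) @ forest_word F1"
    unfolding F by (simp add: pq rotate_append)
  then have "take (length p) (rotate (length (forest_word F1)) (forest_word F)) = p" by simp
  moreover have "length p \<le> L" using assms(3) by (simp add: card_vertices pq)
  ultimately have "real (spine p) \<le> x"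
    using assms(1) unfolding has_long_line_def by (metis not_less)
  then show ?thesis using reads_imp_spine_ge[OF pq(2)] by linarith
qed

lemma diam_le:
  assumes "fst M \<noteq> {}" "\<And>u v. u \<in> fst M \<Longrightarrow> v \<in> fst M \<Longrightarrow> snd M u v \<le> a"
  shows "diam M \<le> a"
  unfolding diam_def using assms by (intro cSUP_least) auto

lemma long_line_if_large_diam:
  fixes a b :: real and s :: "nat \<Rightarrow> nat"
  defines "n \<equiv> deg_seq_size s"
  assumes large: "a < (SUP l\<in>{j<..}. diam (scaled_tree s F l))"
    and len: "length (forest_word F) = n" and n: "0 < n" and L: "n \<le> (j + 1) * L"
    and a: "0 < a" "deg_sigma (empirical_degrees s) * b \<le> a"
  shows "has_long_line L (b * sqrt (real n)) (forest_word F)"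
proof (rule ccontr)
  assume no: "\<not> has_long_line L (b * sqrt (real n)) (forest_word F)"
  let ?\<sigma> = "deg_sigma (empirical_degrees s)"
  have \<sigma>: "?\<sigma> \<ge> 0" by (simp add: deg_sigma_def)
  have "diam (scaled_tree s F l) \<le> a" if l: "j < l" for l
  proof (cases "1 \<le> l \<and> l \<le> length F")
    case True
    define t where "t = ranked_trees F ! (l - 1)"
    have "length (ranked_trees F) = length F" by (metis mset_ranked_trees size_mset)
    then have "t \<in> set (ranked_trees F)" unfolding t_def using True by (intro nth_mem) auto
    then have t: "t \<in> set F" by (metis mset_ranked_trees set_mset_mset)
    have "l * card (vertices t) \<le> n" using ranked_tree_size[of l F] True len by (simp add: t_def)
    also have "n \<le> (j + 1) * L" by (rule L)
    also have "\<dots> \<le> l * L" using l by (intro mult_right_mono) auto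
    finally have size: "card (vertices t) \<le> L" using True by simp
    have tree: "scaled_tree s F l =
        (vertices t, \<lambda>u v. ?\<sigma> / (2 * sqrt (real n)) * real (graph_dist t u v))"
      using True by (simp add: scaled_tree_def t_def n_def Let_def)
    show ?thesis
    proof (rule diam_le)
      show "fst (scaled_tree s F l) \<noteq> {}" unfolding tree fst_conv using Nil_in_vertices[of t] by blast
      fix u v assume "u \<in> fst (scaled_tree s F l)" "v \<in> fst (scaled_tree s F l)"
      then have uv: "u \<in> vertices t" "v \<in> vertices t" by (auto simp: tree)
      have "real (graph_dist t u v) \<le> real (length u) + real (length v)"
        using graph_dist_le[OF uv] by linarith
      \<comment> \<open>The path through the root has two legs; this 2 cancels the one in the
        scaling of the metric.\<close>
      also have "\<dots> \<le> b * sqrt (real n) + b * sqrt (real n)"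
        by (intro add_mono vertex_length_le[OF no t size] uv)
      finally have "?\<sigma> / (2 * sqrt (real n)) * real (graph_dist t u v) \<le>
          ?\<sigma> / (2 * sqrt (real n)) * (b * sqrt (real n) + b * sqrt (real n))"
        using \<sigma> by (intro mult_left_mono) auto
      also have "\<dots> = ?\<sigma> * b" using n by simp
      finally show "snd (scaled_tree s F l) u v \<le> a" using a unfolding tree by simp
    qed
  next
    case False
    then have "scaled_tree s F l = ({[]}, \<lambda>_ _. 0)" by (auto simp: scaled_tree_def)
    then show ?thesis using a by (simp add: diam_def)
  qed
  then have "(SUP l\<in>{j<..}. diam (scaled_tree s F l)) \<le> a"
    by (intro cSUP_least) auto
  then show False using large by simp
qed


section \<open>Asymptotics\<close>

lemma degree_sequence_mset:
  assumes "degree_sequence s"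
  obtains A where "\<And>i. count A i = s i" "size A = deg_seq_size s"
    "mset_charge A = real_of_int (deg_seq_trees s)"
    "(\<Sum>d\<in>#A. (real d)\<^sup>2 + 1) = real (deg_seq_size s) * (deg_sigma2 (empirical_degrees s) + 2)"
    "\<And>i. 2 \<le> i \<Longrightarrow> s i \<le> size (filter_mset (\<lambda>d. 2 \<le> d) A)"
proof -
  have fin: "finite {i. s i > 0}" using assms by (simp add: degree_sequence_def)
  define A where "A = Abs_multiset s"
  have count: "count A i = s i" for i by (simp add: A_def fin)
  have set: "set_mset A = {i. s i > 0}" by (auto simp: set_mset_def count)
  have sum: "(\<Sum>d\<in>#A. f d) = (\<Sum>i | s i > 0. real (s i) * f i)" for f :: "nat \<Rightarrow> real"
    using sum_count_eq_sum_mset[of A f] by (simp add: set count)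
  have size: "size A = deg_seq_size s"
    by (simp add: size_multiset_overloaded_eq set count deg_seq_size_def)
  have charge: "mset_charge A = real_of_int (deg_seq_trees s)"
    unfolding mset_charge_def sum deg_seq_trees_def by (simp add: mult.commute)
  have "deg_seq_size s > 0"
  proof (rule ccontr)
    assume "\<not> deg_seq_size s > 0"
    then have "A = {#}" using size by simp
    then show False using charge assms by (simp add: mset_charge_def degree_sequence_def)
  qed
  moreover have "deg_sigma2 (empirical_degrees s) + 1 =
      (\<Sum>i | s i > 0. (real i)\<^sup>2 * empirical_degrees s i)"
    unfolding deg_sigma2_def using fin
    by (subst suminf_finite[of "{i. s i > 0}"]) (auto simp: empirical_degrees_def)
  then have "deg_sigma2 (empirical_degrees s) + 1 =
      (\<Sum>i | s i > 0. real (s i) * (real i)\<^sup>2) / real (deg_seq_size s)"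
    by (simp add: empirical_degrees_def sum_divide_distrib mult.commute)
  ultimately have "(\<Sum>d\<in>#A. (real d)\<^sup>2) = real (deg_seq_size s) * (deg_sigma2 (empirical_degrees s) + 1)"
    unfolding sum by simp
  then have sq: "(\<Sum>d\<in>#A. (real d)\<^sup>2 + 1) =
      real (deg_seq_size s) * (deg_sigma2 (empirical_degrees s) + 2)"
    by (simp add: sum_mset.distrib size algebra_simps)
  have "s i \<le> size (filter_mset (\<lambda>d. 2 \<le> d) A)" if "2 \<le> i" for i
    using count_le_size[of "filter_mset (\<lambda>d. 2 \<le> d) A" i] that by (simp add: count)
  then show ?thesis using that[of A] count size charge sq by blast
qed

text \<open>The block length must be a power of two for the chaining, at the price of a factor 2.
  The least admissible exponent works, and \<open>J \<le> n\<close> settles exponent 0.\<close>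

lemma exists_dyadic_scale:
  fixes n :: real
  assumes "0 < J" "real J \<le> n"
  shows "\<exists>R. n \<le> real J * 2 ^ R \<and> real J * 2 ^ R \<le> 2 * n"
proof -
  define R where "R = (LEAST R. n \<le> real J * 2 ^ R)"
  obtain m where "n / real J < 2 ^ m" using real_arch_pow[of 2 "n / real J"] by auto
  then have "n \<le> real J * 2 ^ m" using assms by (simp add: divide_less_eq mult.commute)
  then have R: "n \<le> real J * 2 ^ R" unfolding R_def by (rule LeastI)
  have "real J * 2 ^ R \<le> 2 * n"
  proof (cases R)
    case 0
    then show ?thesis using assms by simp
  next
    case (Suc R')
    then have "\<not> n \<le> real J * 2 ^ R'" unfolding R_def by (intro not_less_Least) simp
    then show ?thesis using Suc by simp
  qed
  with R show ?thesis by blast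
qed

text \<open>A bound for fixed size: the degree sequence enters only through constants that can be
  chosen uniformly for large \<open>\<kappa>\<close>. The block length \<open>2 ^ R\<close> is at
  least n / (j + 1), the largest possible size of a tree of rank above j.\<close>

lemma prob_large_diam_le:
  fixes a b B C \<eta> :: real and s :: "nat \<Rightarrow> nat"
  defines "n \<equiv> real (deg_seq_size s)" and "\<sigma> \<equiv> deg_sigma (empirical_degrees s)"
  assumes s: "degree_sequence s" and a: "0 < a" "\<sigma> * b \<le> a" and n: "4 \<le> n" "real j + 1 \<le> n"
    and b: "0 < b" "b \<le> 1 / 2" and B: "1 \<le> B" "\<sigma>\<^sup>2 + 2 \<le> B" and \<sigma>: "0 < \<sigma>"
    and \<eta>: "0 < \<eta>" "\<eta> \<le> 1" and i: "2 \<le> i" "2 * \<eta> \<le> empirical_degrees s i"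
    and c: "real_of_int (deg_seq_trees s) \<le> C * sqrt n"
    and j: "64 * B \<le> \<eta> * (real j + 1)" "1152 * C \<le> \<eta> * b * (real j + 1)"
  shows "measure_pmf.prob (uniform_forest s) {F. (SUP l\<in>{j<..}. diam (scaled_tree s F l)) > a} \<le>
    16 * (324 / (\<eta>\<^sup>2 / (256 * B) * b\<^sup>2))\<^sup>2 / (real j + 1)"
proof -
  obtain A where A: "\<And>i. count A i = s i" "size A = deg_seq_size s"
    "mset_charge A = real_of_int (deg_seq_trees s)"
    "(\<Sum>d\<in>#A. (real d)\<^sup>2 + 1) = n * (deg_sigma2 (empirical_degrees s) + 2)"
    "\<And>i. 2 \<le> i \<Longrightarrow> s i \<le> size (filter_mset (\<lambda>d. 2 \<le> d) A)"
    using degree_sequence_mset[OF s] unfolding n_def by blast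
  define c where "c = nat (deg_seq_trees s)"
  have c': "mset_charge A = real c" "0 < c"
    using s by (auto simp: A c_def degree_sequence_def)
  obtain R where R: "n \<le> real (Suc j) * 2 ^ R" "real (Suc j) * 2 ^ R \<le> 2 * n"
    using exists_dyadic_scale[of "Suc j" n] n by auto
  define P where "P = has_long_line (2 ^ R) (b * sqrt n)"
  let ?E = "{F. (SUP l\<in>{j<..}. diam (scaled_tree s F l)) > a}"
  have "P (forest_word F)" if F: "F \<in> ?E" "F \<in> set_pmf (uniform_forest s)" for F
  proof -
    have "has_degree_sequence F s" using F set_pmf_uniform_forest[OF A(1) c'] by auto
    then have "mset (forest_word F) = A" by (auto simp: has_degree_sequence_iff A multiset_eq_iff)
    then have len: "length (forest_word F) = deg_seq_size s" using A(2) by auto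
    have "real (deg_seq_size s) \<le> real ((j + 1) * 2 ^ R)"
      using R(1) by (simp add: n_def algebra_simps)
    then have "deg_seq_size s \<le> (j + 1) * 2 ^ R" by (simp only: of_nat_le_iff)
    moreover have "0 < deg_seq_size s" using n(1) by (simp add: n_def)
    ultimately show ?thesis
      using long_line_if_large_diam[of a s F j "2 ^ R" b] F(1) len a by (simp add: P_def n_def \<sigma>_def)
  qed
  then have "measure_pmf.prob (uniform_forest s) ?E \<le>
      measure_pmf.prob (uniform_forest s) {F. P (forest_word F)}"
    by (intro measure_pmf.finite_measure_mono_AE) (auto simp: AE_measure_pmf_iff)
  also have "\<dots> = perm_avg A (\<lambda>w. of_bool (P w))"
    by (rule prob_uniform_forest[OF A(1) c']) (simp add: P_def has_long_line_rotate)
  also have "\<dots> \<le> 16 * (324 / (\<eta>\<^sup>2 / (256 * B) * b\<^sup>2))\<^sup>2 / real (Suc j)"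
    unfolding P_def n_def A(2)[symmetric]
  proof (rule perm_avg_has_long_line_le)
    \<comment> \<open>As \<open>\<sigma>\<close> is positive, taking the positive part has changed
      nothing.\<close>
    have "deg_sigma2 (empirical_degrees s) = \<sigma>\<^sup>2"
      using \<sigma> by (auto simp: \<sigma>_def deg_sigma_def max_def split: if_splits)
    then show "(\<Sum>d\<in>#A. (real d)\<^sup>2 + 1) \<le> B * real (size A)"
      using B(2) n(1) mult_right_mono[of "\<sigma>\<^sup>2 + 2" B n] unfolding A(2,4) by (simp add: n_def mult.commute)
    have "2 * \<eta> * n \<le> empirical_degrees s i * n" using i n by (intro mult_right_mono) auto
    also have "\<dots> = real (s i)" using n by (simp add: empirical_degrees_def n_def)
    also have "\<dots> \<le> real (size (filter_mset (\<lambda>d. 2 \<le> d) A))" using A(5) i by simp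
    finally show "2 * \<eta> * real (size A) \<le> real (size (filter_mset (\<lambda>d. 2 \<le> d) A))"
      by (simp add: A(2) n_def)
    show "mset_charge A \<le> C * sqrt (real (size A))" "0 \<le> mset_charge A"
      using c c' A by (auto simp: n_def)
  qed (use R n b B \<eta> j in \<open>auto simp: A(2) n_def add.commute\<close>)
  finally show ?thesis by (simp add: add.commute)
qed

theorem proposition1p11:
  fixes s :: "nat \<Rightarrow> nat \<Rightarrow> nat" and p :: "nat pmf" and lam \<epsilon> a :: real
  assumes "\<And>\<kappa>. degree_sequence (s \<kappa>)"
    and "filterlim (\<lambda>\<kappa>. deg_seq_size (s \<kappa>)) at_top sequentially"
    and "pmf p 1 < 1"
    and "\<And>i. (\<lambda>\<kappa>. empirical_degrees (s \<kappa>) i) \<longlonglongrightarrow> pmf p i"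
    and "summable (\<lambda>i. (real i)\<^sup>2 * pmf p i)"
    and "deg_sigma (pmf p) > 0"
    and "(\<lambda>\<kappa>. deg_sigma (empirical_degrees (s \<kappa>))) \<longlonglongrightarrow> deg_sigma (pmf p)"
    and "lam > 0"
    and "(\<lambda>\<kappa>. real_of_int (deg_seq_trees (s \<kappa>)) /
               (deg_sigma (empirical_degrees (s \<kappa>)) * sqrt (real (deg_seq_size (s \<kappa>))))) \<longlonglongrightarrow> lam"
    and "\<epsilon> > 0"
    and "(\<lambda>\<kappa>. real (max_degree (s \<kappa>))) \<in> O(\<lambda>\<kappa>. real (deg_seq_size (s \<kappa>)) powr ((1 - \<epsilon>) / 2))"
    and "a > 0"
  shows "(\<lambda>j. limsup (\<lambda>\<kappa>. ereal (measure_pmf.prob (uniform_forest (s \<kappa>))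
            {F. (SUP l\<in>{j<..}. diam (scaled_tree (s \<kappa>) F l)) > a}))) \<longlonglongrightarrow> 0"
proof -
  define \<sigma> where "\<sigma> = deg_sigma (pmf p)"
  have \<sigma>: "\<sigma> > 0" using assms(6) by (simp add: \<sigma>_def)
  \<comment> \<open>A law carried by 0 and 1 has second moment \<open>pmf p 1\<close>, which is
    below 1 and would force \<open>deg_sigma\<close> to vanish.\<close>
  have "\<exists>i\<ge>2. pmf p i > 0"
  proof (rule ccontr)
    assume "\<not> (\<exists>i\<ge>2. pmf p i > 0)"
    then have "pmf p i = 0" if "i \<ge> 2" for i
      using that pmf_nonneg[of p i] by (metis not_less order_antisym)
    then have "(real i)\<^sup>2 * pmf p i = 0" if "i \<notin> {1}" for i
      using that by (cases "i \<ge> 2") (auto simp: not_le less_2_cases_iff)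
    then have "(\<Sum>i. (real i)\<^sup>2 * pmf p i) = pmf p 1"
      by (subst suminf_finite[of "{1}"]) auto
    then have "deg_sigma2 (pmf p) \<le> 0" using assms(3) by (simp add: deg_sigma2_def)
    then show False using assms(6) by (simp add: deg_sigma_def)
  qed
  then obtain i where i: "i \<ge> 2" "pmf p i > 0" by blast
  \<comment> \<open>Now 2 * \<open>\<eta>\<close> is half of \<open>pmf p i\<close>, so convergence
    at this one coordinate gives the required share of letters eventually. The summands 1 in the
    constants below are likewise slack for convergence.\<close>
  define \<eta> where "\<eta> = pmf p i / 4"
  define B where "B = (\<sigma> + 1)\<^sup>2 + 2"
  define C where "C = (lam + 1) * (\<sigma> + 1)"
  define b where "b = min (1 / 2) (a / (\<sigma> + 1))"
  define K where "K = 16 * (324 / (\<eta>\<^sup>2 / (256 * B) * b\<^sup>2))\<^sup>2"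
  have \<eta>: "0 < \<eta>" "\<eta> \<le> 1" using i pmf_le_1[of p i] by (auto simp: \<eta>_def)
  have b: "0 < b" "b \<le> 1 / 2" "(\<sigma> + 1) * b \<le> a"
  proof -
    have "(\<sigma> + 1) * b \<le> (\<sigma> + 1) * (a / (\<sigma> + 1))"
      unfolding b_def using \<sigma> by (intro mult_left_mono) auto
    then show "(\<sigma> + 1) * b \<le> a" using \<sigma> by simp
  qed (use \<sigma> assms(12) in \<open>auto simp: b_def min_def\<close>)
  let ?n = "\<lambda>\<kappa>. real (deg_seq_size (s \<kappa>))" and ?\<sigma> = "\<lambda>\<kappa>. deg_sigma (empirical_degrees (s \<kappa>))"
  let ?P = "\<lambda>j \<kappa>. measure_pmf.prob (uniform_forest (s \<kappa>))
            {F. (SUP l\<in>{j<..}. diam (scaled_tree (s \<kappa>) F l)) > a}"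
  have size: "eventually (\<lambda>\<kappa>. x \<le> ?n \<kappa>) sequentially" for x
    using filterlim_compose[OF filterlim_real_sequentially assms(2)]
    by (simp add: filterlim_at_top)
  have bound: "eventually (\<lambda>\<kappa>. ?P j \<kappa> \<le> K / (real j + 1)) sequentially"
    if j: "64 * B \<le> \<eta> * (real j + 1)" "1152 * C \<le> \<eta> * b * (real j + 1)" for j
  proof -
    have "eventually (\<lambda>\<kappa>. 0 < ?\<sigma> \<kappa>) sequentially"
      using order_tendstoD(1)[OF assms(7), of 0] \<sigma> by (simp add: \<sigma>_def)
    moreover have "eventually (\<lambda>\<kappa>. ?\<sigma> \<kappa> < \<sigma> + 1) sequentially"
      using order_tendstoD(2)[OF assms(7), of "\<sigma> + 1"] by (simp add: \<sigma>_def)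
    moreover have "eventually (\<lambda>\<kappa>. 2 * \<eta> < empirical_degrees (s \<kappa>) i) sequentially"
      using order_tendstoD(1)[OF assms(4), of "2 * \<eta>" i] i by (simp add: \<eta>_def)
    moreover have "eventually (\<lambda>\<kappa>. real_of_int (deg_seq_trees (s \<kappa>)) / (?\<sigma> \<kappa> * sqrt (?n \<kappa>)) < lam + 1)
        sequentially"
      using order_tendstoD(2)[OF assms(9), of "lam + 1"] by simp
    ultimately show ?thesis using size[of 4] size[of "real j + 1"]
    proof eventually_elim
      case (elim \<kappa>)
      show ?case unfolding K_def
      proof (rule prob_large_diam_le)
        have "?\<sigma> \<kappa> * b \<le> (\<sigma> + 1) * b" using elim b by (intro mult_right_mono) auto
        then show "?\<sigma> \<kappa> * b \<le> a" using b(3) by linarith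
        have "(?\<sigma> \<kappa>)\<^sup>2 \<le> (\<sigma> + 1)\<^sup>2" using elim by (intro power_mono) auto
        then show "(?\<sigma> \<kappa>)\<^sup>2 + 2 \<le> B" by (simp add: B_def)
        have "real_of_int (deg_seq_trees (s \<kappa>)) \<le> (lam + 1) * (?\<sigma> \<kappa> * sqrt (?n \<kappa>))"
          using elim by (simp add: divide_less_eq less_imp_le split: if_splits)
        also have "\<dots> \<le> (lam + 1) * ((\<sigma> + 1) * sqrt (?n \<kappa>))"
          using elim assms(8) by (intro mult_left_mono mult_right_mono) auto
        finally show "real_of_int (deg_seq_trees (s \<kappa>)) \<le> C * sqrt (?n \<kappa>)" by (simp add: C_def)
        show "1 \<le> B" by (simp add: B_def add_increasing)
        show "2 * \<eta> \<le> empirical_degrees (s \<kappa>) i" using elim by simp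
      qed (use elim assms(1,12) b \<eta> i j in auto)
    qed
  qed
  have "eventually (\<lambda>j. limsup (\<lambda>\<kappa>. ereal (?P j \<kappa>)) \<le> ereal (K / (real j + 1))) sequentially"
  proof -
    have "filterlim (\<lambda>j. \<eta> * (real j + 1)) at_top sequentially"
      using \<eta> by real_asymp
    moreover have "filterlim (\<lambda>j. \<eta> * b * (real j + 1)) at_top sequentially"
      using \<eta> b by real_asymp
    ultimately have "eventually (\<lambda>j. 64 * B \<le> \<eta> * (real j + 1)) sequentially"
      "eventually (\<lambda>j. 1152 * C \<le> \<eta> * b * (real j + 1)) sequentially"
      by (simp_all add: filterlim_at_top)
    then show ?thesis
    proof eventually_elim
      case (elim j)
      from bound[OF this] show ?case
        by (intro Limsup_bounded) (auto elim: eventually_mono)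
    qed
  qed
  moreover have "(\<lambda>j. ereal (K / (real j + 1))) \<longlonglongrightarrow> 0"
  proof -
    have "(\<lambda>j. K / (real j + 1)) \<longlonglongrightarrow> 0" by real_asymp
    then show ?thesis by (simp add: zero_ereal_def)
  qed
  moreover have "0 \<le> limsup (\<lambda>\<kappa>. ereal (?P j \<kappa>))" for j
  proof -
    have "0 \<le> liminf (\<lambda>\<kappa>. ereal (?P j \<kappa>))" by (intro Liminf_bounded) auto
    also have "\<dots> \<le> limsup (\<lambda>\<kappa>. ereal (?P j \<kappa>))" by (intro Liminf_le_Limsup) simp
    finally show ?thesis .
  qed
  ultimately show ?thesis
    by (rule tendsto_sandwich[OF always_eventually[OF allI] _ tendsto_const, rotated 1])
qed

end
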